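(* Let $K,N\in\mathbb{N}$ be positive integers and $M>0$ a real number, all fixed, and let $\zeta_K=e^{2\pi i/K}$. Suppose that $F(q)$ is analytic for $q=e^{-z}$ where $z=x+iy\in\mathbb{C}$ satisfies $x>0$ and $|y|<\pi$, that $F(q)$ has an expansion $F(q)=\sum_{n=0}^\infty c(n)q^n$ near $1$, and that $F(\zeta_K q)=F(q)$. Suppose further that there are $A\in\mathbb{R}^+$, $B\in\mathbb{R}^+$, $\kappa\in\mathbb{R}^+$ and $\alpha_0,\dots,\alpha_{N-1}\in\mathbb{C}$ such that: (1) (major arc) as $z\to 0$ in the bounded cone $|y|\le Mx$, $$F(e^{-z})=z^B e^{\frac{A}{z}}\left(\sum_{j=0}^{N-1}\alpha_j z^j+O_M(|z|^N)\right);$$ (2) (minor arc) as $x\to0^+$, for $z=x+iy$ in the region $Mx\le y\le \frac{2\pi}{K}-Mx$ (uniformly in $y$), $$|F(e^{-z})|\ll_M e^{\frac{1}{\operatorname{Re}(z)}(A-\kappa)}.$$ Define $C(n)=c(Kn)$, and assume that $\{C(n)\}$ is a sequence of real numbers. Then the sequence $C(n)$ asymptotically satisfies all of the higher order Turán inequalities; that is, for every $d\ge1$, for all sufficiently large $n$, the sequence $C$ satisfies the Turán inequalities of order $d$ at $n$.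
   Context: For a sequence of real numbers $\{\alpha(n)\}$, the Jensen polynomial of degree $d$ and shift $n$ is $J_\alpha^{d,n}(X)=\sum_{j=0}^d\binom{d}{j}\alpha(n+j)X^j$. Turán inequalities of order $d$ at $n$: the polynomial $J_\alpha^{d,n}(X)$ has degree exactly $d$ and, if $\beta_1,\dots,\beta_d$ are its complex roots listed with multiplicity and $S_0=d$, $S_k=\beta_1^k+\dots+\beta_d^k$ for $k\ge1$, then the Hankel determinants satisfy $$\Delta_k^{(d)}=\det\left(S_{i+j}\right)_{0\le i,j\le k-1}\ge0\qquad\text{for all }1\le k\le d.$$ (The $S_k$, hence these inequalities, are determined by the coefficients of the polynomial.) The power $z^B$ is taken with the principal branch. $O_M$ and $\ll_M$ mean that the implied constants may depend on $M$.
   Formalization: It is additionally assumed that at least one of α_0,…,α_{N-1} is nonzero; without this the claim fails for F = 0 with all α_j = 0, where every Jensen polynomial is zero and never has degree exactly d. *)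

theory Defs
  imports
    "HOL-Complex_Analysis.Complex_Analysis"
    "HOL-Library.Landau_Symbols"
    "Jordan_Normal_Form.Determinant"
begin

definition jensen_poly :: "(nat \<Rightarrow> real) \<Rightarrow> nat \<Rightarrow> nat \<Rightarrow> real poly" where
  "jensen_poly \<alpha> d n = (\<Sum>j\<le>d. monom (of_nat (d choose j) * \<alpha> (n + j)) j)"

text \<open>For a nonzero polynomial the multiset \<open>proots\<close> counts every root with its multiplicity.
  As \<open>0 ^ 0 = 1\<close>, the zeroth power sum is the number of roots, also if zero is one of them.\<close>

definition root_power_sum :: "real poly \<Rightarrow> nat \<Rightarrow> complex" where
  "root_power_sum p k = (\<Sum>\<beta>\<in>#proots (map_poly complex_of_real p). \<beta> ^ k)"

text \<open>\<open>Determinant.det\<close> is the determinant of Jordan-Normal-Form matrices, whose dimension is a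
  natural number rather than a type.\<close>

definition power_sum_hankel :: "real poly \<Rightarrow> nat \<Rightarrow> complex" where
  "power_sum_hankel p k =
     Determinant.det (Matrix.mat k k (\<lambda>(i, j). root_power_sum p (i + j)))"

text \<open>The power sums are taken over complex roots, so nonnegativity of the complex number
  \<open>\<Delta>\<close> is spelled out as being real with nonnegative real part.\<close>

definition turan_inequalities :: "(nat \<Rightarrow> real) \<Rightarrow> nat \<Rightarrow> nat \<Rightarrow> bool" where
  "turan_inequalities \<alpha> d n \<longleftrightarrow>
     degree (jensen_poly \<alpha> d n) = d \<and>
     (\<forall>k\<in>{1..d}. let \<Delta> = power_sum_hankel (jensen_poly \<alpha> d n) k in \<Delta> \<in> \<real> \<and> 0 \<le> Re \<Delta>)"

text \<open>The points \<open>exp (- z)\<close> with \<open>Re z > 0\<close> and \<open>\<bar>Im z\<bar> < \<pi>\<close>, i.e. the open unit disc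
  slit along the nonpositive reals.\<close>

definition q_domain :: "complex set" where
  "q_domain = (\<lambda>z. exp (- z)) ` {z. 0 < Re z \<and> \<bar>Im z\<bar> < pi}"

definition major_cone :: "real \<Rightarrow> complex set" where
  "major_cone M = {z. 0 < Re z \<and> \<bar>Im z\<bar> \<le> M * Re z}"

end

theory Submission
  imports Defs "Jordan_Normal_Form.Char_Poly" "HOL-Probability.Characteristic_Functions"
    "HOL-Real_Asymp.Real_Asymp"
begin

text \<open>The idea is that the Jensen polynomials of \<open>C\<close>, in suitable coordinates, converge to Hermite
polynomials, whose roots are real and simple.

Put \<open>G w = (\<Sum>m. C m * exp (- w) ^ m)\<close>. Cauchy's formula on the circle \<open>Re w = s\<close> and the binomial
theorem give, for real \<open>X\<close>,
\<open>2 \<pi> J(X) = \<integral> G(w) exp(n w) (1 + X exp w)^d dy\<close> with \<open>w = s + i y\<close>,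
where \<open>J\<close> is the Jensen polynomial of degree \<open>d\<close> and shift \<open>n\<close>: the whole polynomial sits inside
one integral as the \<open>d\<close>-th power of a linear factor (\<open>jensen_poly_integral\<close>). With \<open>s = \<surd>(A / n)\<close>
the exponent \<open>A / w + n w\<close> has its saddle point at \<open>w = s\<close> and is Gaussian there, on the scale
\<open>\<delta> = \<surd>(s^3 / (2 A))\<close>. Choosing \<open>X = - exp(- s) (1 - \<delta> Y)\<close> places the zero of the linear factor
at the same distance \<open>\<delta>\<close> from the saddle point: for \<open>y = \<delta> t\<close> the factor is
\<open>\<delta> (Y - i t)\<close> to first order. After division by a positive real scale, dominated convergence on the
major arc and the exponential gain \<open>\<kappa>\<close> on the minor arc show that \<open>J(X)\<close> converges to a
nonzero constant times \<open>\<integral> exp(- t^2 / 2) (Y - i t)^d dt\<close>, that is, times the Hermite polynomial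
at \<open>Y\<close> (\<open>major_arc_limit\<close>, \<open>minor_arc_limit\<close>, \<open>jensen_poly_tendsto_hermite\<close>).

Comparing asymptotic expansions of the individual coefficients \<open>C(n), \<dots>, C(n + d)\<close> would be much
harder, because their leading terms cancel in \<open>J\<close>. Here that cancellation has already taken place
in the \<open>d\<close>-th power under the integral sign, and the first nonvanishing term of the major-arc
expansion decides the limit.

The Hermite polynomial of degree \<open>d\<close> alternates in sign at \<open>d + 1\<close> points
(\<open>hermite_sign_changes\<close>), so for large \<open>n\<close> the polynomial \<open>J\<close> alternates at \<open>d + 1\<close> points too and has
\<open>d\<close> distinct real roots. Its Hankel matrices of power sums are then real Gram matrices, hence
positive semidefinite (\<open>turan_inequalities_of_sign_changes\<close>).

It remains to produce \<open>G\<close> from \<open>F\<close>. The expansion near \<open>1\<close> forces convergence on the whole unit disc,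
the identity theorem spreads it over the slit disc, the rotational symmetry kills the coefficients
whose index is not a multiple of \<open>K\<close>, and \<open>G w = F (exp (- w / K))\<close> turns one period of length
\<open>2 \<pi> / K\<close> into a full circle.\<close>

section \<open>Hankel determinants of polynomials with real roots\<close>

lemma poly_char_poly_uminus_0:
  assumes "A \<in> carrier_mat k k"
  shows "poly (char_poly (- A)) 0 = Determinant.det (A :: real mat)"
  unfolding char_poly_def
  by (rule poly_det_cong[of _ k]) (use assms in \<open>auto simp: char_poly_matrix_def\<close>)

text \<open>The monic polynomial \<open>char_poly (- A)\<close> has the value \<open>det A\<close> at \<open>0\<close>. If this were negative there would be
a positive root \<open>t\<close>, and \<open>- t\<close> would be a negative eigenvalue of \<open>A\<close>.\<close>

lemma det_nonneg_of_psd: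
  fixes A :: "real mat"
  assumes A: "A \<in> carrier_mat k k"
    and psd: "\<And>v. v \<in> carrier_vec k \<Longrightarrow> 0 \<le> scalar_prod v (A *\<^sub>v v)"
  shows "0 \<le> Determinant.det A"
proof (rule ccontr)
  assume "\<not> 0 \<le> Determinant.det A"
  let ?p = "char_poly (- A)"
  have neg: "poly ?p 0 < 0"
    using \<open>\<not> _\<close> by (simp add: poly_char_poly_uminus_0[OF A])
  have mA: "- A \<in> carrier_mat k k" using A by simp
  have "lead_coeff ?p = 1" using degree_monic_char_poly[OF mA] by simp
  then obtain b where b: "\<And>x. x \<ge> b \<Longrightarrow> poly ?p x \<ge> 1"
    using poly_pinfty_gt_lc[of ?p] by auto
  have "0 < max b 1" "poly ?p (max b 1) > 0" using b[of "max b 1"] by auto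
  from poly_IVT_pos[OF this(1) neg this(2)] obtain t where t: "t > 0" "poly ?p t = 0" by auto
  then obtain v where v: "v \<in> carrier_vec k" "v \<noteq> 0\<^sub>v k" "(- A) *\<^sub>v v = t \<cdot>\<^sub>v v"
    using eigenvalue_root_char_poly[OF mA, of t] A unfolding eigenvalue_def eigenvector_def by auto
  have "A *\<^sub>v v = - (t \<cdot>\<^sub>v v)"
    using v A by (metis uminus_mult_mat_vec carrier_matD(2) carrier_vecD uminus_uminus_vec)
  then have "scalar_prod v (A *\<^sub>v v) = - (t * scalar_prod v v)"
    using v(1) by (simp add: scalar_prod_def sum_negf sum_distrib_left mult_ac)
  moreover have "scalar_prod v v > 0"
    using v(1,2) conjugate_square_greater_0_vec[of v k] by (simp add: vec_eq_iff)
  ultimately show False using psd[OF v(1)] mult_pos_pos[OF t(1)] by fastforce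
qed

text \<open>The quadratic form of the Hankel matrix at \<open>v\<close> is the sum over \<open>r\<close> of the squares of the values at \<open>r\<close> of
the polynomial with coefficient vector \<open>v\<close>.\<close>

lemma det_real_hankel_nonneg:
  fixes S :: "real set"
  assumes "finite S"
  shows "0 \<le> Determinant.det (Matrix.mat k k (\<lambda>(i, j). \<Sum>r\<in>S. r ^ (i + j)))"
proof (rule det_nonneg_of_psd)
  fix v :: "real Matrix.vec" assume v: "v \<in> carrier_vec k"
  let ?H = "Matrix.mat k k (\<lambda>(i, j). \<Sum>r\<in>S. r ^ (i + j))"
  have "scalar_prod v (?H *\<^sub>v v) = (\<Sum>i<k. \<Sum>j<k. \<Sum>r\<in>S. (vec_index v i * r ^ i) * (vec_index v j * r ^ j))"
    using v by (auto simp: scalar_prod_def power_add sum_distrib_left sum_distrib_right mult_ac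
        lessThan_atLeast0 intro!: sum.cong)
  also have "\<dots> = (\<Sum>r\<in>S. (\<Sum>i<k. vec_index v i * r ^ i)\<^sup>2)"
    by (simp add: power2_eq_square sum_product sum.swap[of _ S])
  finally show "0 \<le> scalar_prod v (?H *\<^sub>v v)" by (simp add: sum_nonneg)
qed simp

lemma degree_jensen_poly_le: "degree (jensen_poly \<alpha> d n) \<le> d"
  unfolding jensen_poly_def
  by (intro degree_sum_le) (auto intro: order_trans[OF degree_monom_le])

text \<open>As many distinct real roots as the degree allows exhaust the complex roots, each being simple.\<close>

lemma root_power_sum_real_roots:
  fixes p :: "real poly"
  assumes "finite S" "\<And>r. r \<in> S \<Longrightarrow> poly p r = 0" "card S = degree p" "p \<noteq> 0"
  shows "root_power_sum p k = of_real (\<Sum>r\<in>S. r ^ k)"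
proof -
  let ?P = "map_poly complex_of_real p" and ?T = "complex_of_real ` S"
  have P0: "?P \<noteq> 0" using assms(4) by simp
  have "mset_set ?T \<subseteq># proots ?P"
  proof (rule mset_subset_eqI)
    fix a
    show "count (mset_set ?T) a \<le> count (proots ?P) a"
      using assms(1,2) P0 by (auto simp: count_mset_set' Suc_le_eq order_gt_0_iff)
  qed
  moreover have "size (proots ?P) \<le> size (mset_set ?T)"
    using assms(3) by (simp add: size_proots_complex card_image inj_on_def degree_map_poly)
  ultimately have "proots ?P = mset_set ?T"
    by (metis mset_subset_size subset_mset.less_le not_less)
  then have "root_power_sum p k = (\<Sum>\<beta>\<in>?T. \<beta> ^ k)"
    by (simp add: root_power_sum_def sum_unfold_sum_mset)
  also have "\<dots> = of_real (\<Sum>r\<in>S. r ^ k)"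
    by (simp add: sum.reindex inj_on_def)
  finally show ?thesis .
qed

lemma turan_inequalities_of_real_roots:
  assumes "finite S" "\<And>r. r \<in> S \<Longrightarrow> poly (jensen_poly \<alpha> d n) r = 0" "card S = d"
    and nz: "jensen_poly \<alpha> d n \<noteq> 0"
  shows "turan_inequalities \<alpha> d n"
proof -
  let ?J = "jensen_poly \<alpha> d n"
  have "S \<subseteq> {r. poly ?J r = 0}" using assms(2) by auto
  then have "card S \<le> degree ?J"
    by (rule order_trans[OF card_mono[OF poly_roots_finite[OF nz]] card_poly_roots_bound[OF nz]])
  then have deg: "degree ?J = d" using degree_jensen_poly_le[of \<alpha> d n] assms(3) by simp
  have "power_sum_hankel ?J k
      = Determinant.det (map_mat complex_of_real (Matrix.mat k k (\<lambda>(i, j). \<Sum>r\<in>S. r ^ (i + j))))" for k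
    unfolding power_sum_hankel_def
    by (rule arg_cong[where f = Determinant.det], rule eq_matI)
      (use assms deg in \<open>auto simp: root_power_sum_real_roots[of S]\<close>)
  then have "power_sum_hankel ?J k
      = of_real (Determinant.det (Matrix.mat k k (\<lambda>(i, j). \<Sum>r\<in>S. r ^ (i + j))))" for k
    by (simp add: of_real_hom.hom_det)
  with deg show ?thesis
    using det_real_hankel_nonneg[OF assms(1)] by (auto simp: turan_inequalities_def Let_def)
qed

text \<open>The form in which real-rootedness survives a limit: the strict signs at finitely many points are stable
under small perturbations. The factor \<open>\<sigma>\<close> fixes the overall sign.\<close>

lemma turan_inequalities_of_sign_changes:
  fixes y :: "nat \<Rightarrow> real"
  assumes mono: "\<And>i. i < d \<Longrightarrow> y i < y (Suc i)"
    and alt: "\<And>i. i \<le> d \<Longrightarrow> 0 < \<sigma> * (-1) ^ i * poly (jensen_poly \<alpha> d n) (y i)"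
  shows "turan_inequalities \<alpha> d n"
proof -
  let ?J = "jensen_poly \<alpha> d n"
  have "\<exists>r. y i < r \<and> r < y (Suc i) \<and> poly ?J r = 0" if "i < d" for i
  proof -
    have "poly ?J (y i) * poly ?J (y (Suc i)) < 0"
    proof -
      let ?a = "poly ?J (y i)" and ?b = "poly ?J (y (Suc i))"
      have "0 < (\<sigma> * (-1) ^ i * ?a) * (\<sigma> * (-1) ^ Suc i * ?b)"
        using alt[of i] alt[of "Suc i"] that by (intro mult_pos_pos[OF alt alt]) auto
      also have "\<dots> = - (\<sigma>\<^sup>2 * ((-1) ^ i)\<^sup>2 * (?a * ?b))" by (simp add: power2_eq_square)
      also have "\<dots> = - (\<sigma>\<^sup>2 * (?a * ?b))" by (simp flip: power_mult add: mult.commute)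
      finally show ?thesis by (simp add: mult_less_0_iff zero_less_mult_iff)
    qed
    from poly_IVT[OF mono[OF that] this] show ?thesis by blast
  qed
  then obtain r where r: "\<And>i. i < d \<Longrightarrow> y i < r i \<and> r i < y (Suc i) \<and> poly ?J (r i) = 0" by metis
  have le: "y i \<le> y j" if "i \<le> j" "j \<le> d" for i j
    using that
  proof (induction j rule: dec_induct)
    case (step m)
    then show ?case using mono[of m] by simp
  qed simp
  have less: "r i < r j" if "i < j" "j < d" for i j
    using r[of i] r[of j] le[of "Suc i" j] that by simp
  then have "inj_on r {..<d}"
    using less by (intro linorder_inj_onI') (metis lessThan_iff less_irrefl)
  moreover have "?J \<noteq> 0" using alt[of 0] by auto
  ultimately show ?thesis
    using r by (intro turan_inequalities_of_real_roots[of "r ` {..<d}"]) (auto simp: card_image)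
qed

section \<open>Hermite polynomials and Gaussian moments\<close>

lemma poly_times_gaussian_tendsto_0:
  fixes p :: "real poly"
  shows "((\<lambda>x. poly p x * exp (- x\<^sup>2 / 2)) \<longlongrightarrow> 0) at_top"
    and "((\<lambda>x. poly p x * exp (- x\<^sup>2 / 2)) \<longlongrightarrow> 0) at_bot"
proof -
  have top: "((\<lambda>x. poly p x * exp (- x\<^sup>2 / 2)) \<longlongrightarrow> 0) at_top" for p :: "real poly"
  proof -
    have "((\<lambda>x. \<Sum>i\<le>degree p. coeff p i * (x ^ i * exp (- x\<^sup>2 / 2))) \<longlongrightarrow> (\<Sum>i\<le>degree p. coeff p i * 0)) at_top"
    proof (intro tendsto_intros)
      fix i show "((\<lambda>x::real. x ^ i * exp (- x\<^sup>2 / 2)) \<longlongrightarrow> 0) at_top" by real_asymp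
    qed
    then show ?thesis by (simp add: poly_altdef sum_distrib_right mult.assoc)
  qed
  show "((\<lambda>x. poly p x * exp (- x\<^sup>2 / 2)) \<longlongrightarrow> 0) at_top" by (rule top)
  show "((\<lambda>x. poly p x * exp (- x\<^sup>2 / 2)) \<longlongrightarrow> 0) at_bot"
    using top[of "pcompose p [:0, -1:]"] by (simp add: filterlim_at_bot_mirror poly_pcompose)
qed

text \<open>The probabilists' Hermite polynomials. The recursion says that passing from \<open>d\<close> to \<open>Suc d\<close> is
differentiation of \<open>hermite d\<close> times the Gaussian \<open>exp (- x^2 / 2)\<close>, up to sign.\<close>

fun hermite :: "nat \<Rightarrow> real poly" where
  "hermite 0 = 1"
| "hermite (Suc d) = [:0, 1:] * hermite d - pderiv (hermite d)"

lemma pderiv_hermite_Suc: "pderiv (hermite (Suc d)) = Polynomial.smult (of_nat (Suc d)) (hermite d)"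
proof (induction d)
  case 0
  show ?case by (simp add: pderiv_mult pderiv_pCons one_pCons)
next
  case (Suc d)
  have "pderiv (hermite (Suc (Suc d)))
      = hermite (Suc d) + [:0, 1:] * pderiv (hermite (Suc d)) - pderiv (pderiv (hermite (Suc d)))"
    by (simp add: pderiv_mult pderiv_diff pderiv_pCons del: hermite.simps(2))
      (simp add: pderiv_mult pderiv_diff pderiv_pCons one_pCons[symmetric] hermite.simps(2)[of "Suc d"] del: hermite.simps(2))
  also have "\<dots> = hermite (Suc d) + Polynomial.smult (of_nat (Suc d)) ([:0, 1:] * hermite d - pderiv (hermite d))"
    by (simp only: Suc.IH pderiv_smult smult_diff_right mult_smult_right add_diff_eq)
  also have "\<dots> = Polynomial.smult (of_nat (Suc (Suc d))) (hermite (Suc d))"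
    unfolding hermite.simps(2)[symmetric] of_nat_Suc[of "Suc d"] smult_add_left by simp
  finally show ?case .
qed

lemma hermite_Suc_Suc:
  "poly (hermite (Suc (Suc d))) x
     = x * poly (hermite (Suc d)) x - of_nat (Suc d) * poly (hermite d) x"
  unfolding hermite.simps(2)[of "Suc d"] pderiv_hermite_Suc by simp

lemma gaussian_times_hermite_deriv:
  "((\<lambda>x. poly (hermite d) x * exp (- x\<^sup>2 / 2)) has_real_derivative
     - poly (hermite (Suc d)) x * exp (- x\<^sup>2 / 2)) (at x)"
  by (auto intro!: derivative_eq_intros simp: algebra_simps)

text \<open>Let \<open>g\<close> be \<open>hermite d\<close> times the Gaussian, so that \<open>- g'\<close> has the sign of \<open>hermite (Suc d)\<close>. Between two
successive alternation points of \<open>g\<close> the mean value theorem gives a point where \<open>g'\<close> has the sign of the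
change. As \<open>g\<close> decays at both ends, there is one further such point on either side, so their number
grows by one.\<close>

lemma hermite_sign_changes:
  "\<exists>y. (\<forall>i<d. y i < y (Suc i)) \<and> (\<forall>i\<le>d. 0 < (-1) ^ (d + i) * poly (hermite d) (y i))"
proof (induction d)
  case 0
  show ?case by (intro exI[of _ "\<lambda>_. 0"]) simp
next
  case (Suc d)
  then obtain y where y: "\<And>i. i < d \<Longrightarrow> y i < y (Suc i)"
    "\<And>i. i \<le> d \<Longrightarrow> 0 < (-1) ^ (d + i) * poly (hermite d) (y i)" by auto
  define g where "g = (\<lambda>x. poly (hermite d) x * exp (- x\<^sup>2 / 2))"
  have g_sign: "0 < (-1) ^ (d + i) * g (y i)" if "i \<le> d" for i
    using mult_pos_pos[OF y(2)[OF that] exp_gt_zero[of "- (y i)\<^sup>2 / 2"]] by (simp add: g_def mult.assoc)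
  then have g_nz: "g (y i) \<noteq> 0" if "i \<le> d" for i
    using that by (metis mult_zero_right less_irrefl)
  have step: "\<exists>x. u < x \<and> x < v \<and> 0 < \<sigma> * (- 1) * poly (hermite (Suc d)) x"
    if uv: "u < v" "\<sigma> * g u < \<sigma> * g v" for u v \<sigma>
  proof -
    obtain x where x: "u < x" "x < v"
      "g v - g u = (v - u) * (- poly (hermite (Suc d)) x * exp (- x\<^sup>2 / 2))"
      using MVT2[OF uv(1), of g "\<lambda>x. - poly (hermite (Suc d)) x * exp (- x\<^sup>2 / 2)"]
        gaussian_times_hermite_deriv[of d] unfolding g_def by blast
    have pos: "0 < (v - u) * exp (- x\<^sup>2 / 2)" using uv(1) by simp
    have "0 < \<sigma> * (g v - g u)" using uv(2) by (simp add: algebra_simps)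
    also have "\<dots> = (\<sigma> * (-1) * poly (hermite (Suc d)) x) * ((v - u) * exp (- x\<^sup>2 / 2))"
      unfolding x(3) by (simp add: algebra_simps del: hermite.simps)
    finally have "0 < \<sigma> * (-1) * poly (hermite (Suc d)) x"
      using pos by (rule zero_less_mult_pos2)
    with x(1,2) show ?thesis by blast
  qed
  have "eventually (\<lambda>x. \<bar>g x\<bar> < \<bar>g (y 0)\<bar>) at_bot"
    using order_tendstoD(2)[OF tendsto_rabs_zero[OF poly_times_gaussian_tendsto_0(2)[of "hermite d"]], of "\<bar>g (y 0)\<bar>"]
      g_nz[of 0] unfolding g_def by simp
  then obtain u where u: "u < y 0" "\<bar>g u\<bar> < \<bar>g (y 0)\<bar>"
    by (metis (mono_tags, lifting) eventually_at_bot_linorder dense eventually_at_bot_dense lt_ex min_less_iff_conj)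
  have "eventually (\<lambda>x. \<bar>g x\<bar> < \<bar>g (y d)\<bar>) at_top"
    using order_tendstoD(2)[OF tendsto_rabs_zero[OF poly_times_gaussian_tendsto_0(1)[of "hermite d"]], of "\<bar>g (y d)\<bar>"]
      g_nz[of d] unfolding g_def by simp
  then obtain v where v: "y d < v" "\<bar>g v\<bar> < \<bar>g (y d)\<bar>"
    by (metis (mono_tags, lifting) eventually_at_top_dense gt_ex max_less_iff_conj)
  \<comment> \<open>The \<open>i\<close>-th new point is sought between \<open>p i\<close> and \<open>q i\<close>, where \<open>u\<close> and \<open>v\<close> serve as outer endpoints.\<close>
  define p where "p i = (if i = 0 then u else y (i - 1))" for i
  define q where "q i = (if i \<le> d then y i else v)" for i
  have "\<exists>x. p i < x \<and> x < q i \<and> 0 < (-1) ^ (Suc d + i) * poly (hermite (Suc d)) x" if "i \<le> Suc d" for i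
  proof -
    have "p i < q i"
      using u(1) v(1) y(1)[of "i - 1"] that by (cases i) (auto simp: p_def q_def le_Suc_eq Suc_le_eq)
    moreover have "(-1) ^ (d + i) * g (p i) < (-1) ^ (d + i) * g (q i)"
    proof (cases i)
      case 0
      then show ?thesis using u(2) g_sign[of 0] by (cases "even d") (auto simp: p_def q_def)
    next
      case (Suc j)
      have j: "0 < (-1) ^ (d + j) * g (y j)" using g_sign[of j] that Suc by simp
      show ?thesis
      proof (cases "i \<le> d")
        case True
        then show ?thesis using j g_sign[of i] Suc by (auto simp: p_def q_def)
      next
        case False
        then have "j = d" using Suc that by simp
        then show ?thesis using j v(2) Suc by (auto simp: p_def q_def simp flip: mult_2)
      qed
    qed
    ultimately show ?thesis using step[of "p i" "q i" "(-1) ^ (d + i)"] by auto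
  qed
  then obtain x where x: "\<And>i. i \<le> Suc d \<Longrightarrow>
      p i < x i \<and> x i < q i \<and> 0 < (-1) ^ (Suc d + i) * poly (hermite (Suc d)) (x i)" by metis
  have "x i < x (Suc i)" if "i < Suc d" for i
    using x[of i] x[of "Suc i"] that by (auto simp: p_def q_def)
  with x show ?case by blast
qed

lemma integrable_gaussian_power:
  "integrable lborel (\<lambda>t. complex_of_real (std_normal_density t) * (of_real Y - \<i> * of_real t) ^ d)"
proof -
  have "integrable lborel (\<lambda>t. \<Sum>k\<le>d. (of_nat (d choose k) * of_real Y ^ (d - k) * (- \<i>) ^ k)
      * complex_of_real (std_normal_density t * t ^ k))"
    by (intro Bochner_Integration.integrable_sum integrable_mult_right integrable_of_real
        integrable_std_normal_moment)
  also have "(\<lambda>t. \<Sum>k\<le>d. (of_nat (d choose k) * of_real Y ^ (d - k) * (- \<i>) ^ k)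
      * complex_of_real (std_normal_density t * t ^ k))
    = (\<lambda>t. complex_of_real (std_normal_density t) * (of_real Y - \<i> * of_real t) ^ d)"
  proof
    fix t :: real
    have "(of_real Y - \<i> * of_real t) ^ d = (- \<i> * of_real t + complex_of_real Y) ^ d" by simp
    also have "\<dots> = (\<Sum>k\<le>d. of_nat (d choose k) * (- \<i> * of_real t) ^ k * complex_of_real Y ^ (d - k))"
      by (rule binomial_ring)
    finally have binom: "(of_real Y - \<i> * of_real t) ^ d
        = (\<Sum>k\<le>d. of_nat (d choose k) * ((- \<i>) ^ k * of_real t ^ k) * complex_of_real Y ^ (d - k))"
      by (simp only: power_mult_distrib)
    show "(\<Sum>k\<le>d. (of_nat (d choose k) * of_real Y ^ (d - k) * (- \<i>) ^ k)
        * complex_of_real (std_normal_density t * t ^ k))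
      = complex_of_real (std_normal_density t) * (of_real Y - \<i> * of_real t) ^ d"
      unfolding binom by (simp add: sum_distrib_left mult_ac)
  qed
  finally show ?thesis .
qed

lemma gaussian_power_tendsto_0:
  fixes Y :: real and d :: nat
  defines "f \<equiv> (\<lambda>t. complex_of_real (std_normal_density t) * (of_real Y - \<i> * of_real t) ^ d)"
  shows "(f \<longlongrightarrow> 0) at_top" and "(f \<longlongrightarrow> 0) at_bot"
proof -
  have le: "norm (f t) \<le> 1 / sqrt (2 * pi) * (poly ([:\<bar>Y\<bar>, \<sigma>:] ^ d) t * exp (- t\<^sup>2 / 2))"
    if "\<sigma> * t = \<bar>t\<bar>" for t \<sigma>
  proof -
    have "norm (of_real Y - \<i> * of_real t :: complex) \<le> \<bar>Y\<bar> + \<bar>t\<bar>"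
      by (rule order_trans[OF norm_triangle_ineq4]) (simp add: norm_mult)
    then have "norm ((of_real Y - \<i> * of_real t :: complex) ^ d) \<le> (\<bar>Y\<bar> + \<bar>t\<bar>) ^ d"
      by (simp add: norm_power power_mono)
    then have "std_normal_density t * norm ((of_real Y - \<i> * of_real t :: complex) ^ d)
        \<le> std_normal_density t * (\<bar>Y\<bar> + \<bar>t\<bar>) ^ d"
      by (intro mult_left_mono) auto
    moreover have "norm (f t) = std_normal_density t * norm ((of_real Y - \<i> * of_real t :: complex) ^ d)"
      by (simp add: f_def norm_mult)
    ultimately show ?thesis
      using that by (simp add: std_normal_density_def poly_power mult_ac)
  qed
  show "(f \<longlongrightarrow> 0) at_top"
  proof (rule Lim_null_comparison)
    show "eventually (\<lambda>t. norm (f t) \<le> 1 / sqrt (2 * pi) * (poly ([:\<bar>Y\<bar>, 1:] ^ d) t * exp (- t\<^sup>2 / 2))) at_top"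
      using eventually_ge_at_top[of 0] by eventually_elim (rule le, simp)
  qed (rule tendsto_mult_right_zero[OF poly_times_gaussian_tendsto_0(1)])
  show "(f \<longlongrightarrow> 0) at_bot"
  proof (rule Lim_null_comparison)
    show "eventually (\<lambda>t. norm (f t) \<le> 1 / sqrt (2 * pi) * (poly ([:\<bar>Y\<bar>, -1:] ^ d) t * exp (- t\<^sup>2 / 2))) at_bot"
      using eventually_le_at_bot[of 0] by eventually_elim (rule le, simp)
  qed (rule tendsto_mult_right_zero[OF poly_times_gaussian_tendsto_0(2)])
qed

text \<open>Both sides satisfy the three-term recursion of the Hermite polynomials. For the left-hand side this is
integration by parts: the derivative of the Gaussian times \<open>(Y - i t)^(d + 1)\<close> is the combination of the
powers \<open>d + 2\<close>, \<open>d + 1\<close> and \<open>d\<close>, and it integrates to zero.\<close>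

lemma integral_gaussian_power:
  "(LINT t|lborel. complex_of_real (std_normal_density t) * (of_real Y - \<i> * of_real t) ^ d)
     = of_real (poly (hermite d) Y)"
proof (induction d rule: induct_nat_012)
  case 0
  show ?case using integral_std_normal_moment_even[of 0] by simp
next
  case 1
  have "complex_of_real (std_normal_density t) * (of_real Y - \<i> * of_real t) ^ Suc 0
     = of_real Y * of_real (std_normal_density t * t ^ 0) - \<i> * of_real (std_normal_density t * t ^ 1)" for t
    by (simp add: algebra_simps)
  then show ?case
    using integral_std_normal_moment_even[of 0] integral_std_normal_moment_odd[of 0]
      integrable_std_normal_moment[of 0] integrable_std_normal_moment[of 1]
    by (simp add: Bochner_Integration.integral_diff del: of_real_mult)
next
  case (ge2 d)
  let ?I = "\<lambda>d t. complex_of_real (std_normal_density t) * (of_real Y - \<i> * of_real t) ^ d"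
  define f where "f t = - \<i> * (?I (Suc (Suc d)) t - of_real Y * ?I (Suc d) t + of_nat (Suc d) * ?I d t)" for t
  have int_f: "integrable lborel f"
    unfolding f_def by (intro integrable_mult_right Bochner_Integration.integrable_add
        Bochner_Integration.integrable_diff integrable_gaussian_power)
  have deriv: "(?I (Suc d) has_vector_derivative f t) (at t)" for t
  proof -
    have "(?I (Suc d) has_vector_derivative
      (complex_of_real (- t * std_normal_density t) * (of_real Y - \<i> * of_real t) ^ Suc d
        + complex_of_real (std_normal_density t) * (of_nat (Suc d) * (of_real Y - \<i> * of_real t) ^ d * (- \<i>)))) (at t)"
    proof -
      let ?\<phi> = "\<lambda>z. complex_of_real (1 / sqrt (2 * pi)) * exp (- z\<^sup>2 / 2) * (of_real Y - \<i> * z) ^ Suc d"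
      have \<phi>: "complex_of_real (std_normal_density x) = complex_of_real (1 / sqrt (2 * pi)) * exp (- (of_real x)\<^sup>2 / 2)" for x
        unfolding std_normal_density_def of_real_mult exp_of_real[symmetric] by simp
      have "(?\<phi> has_field_derivative
         (complex_of_real (1 / sqrt (2 * pi)) * (exp (- (of_real t)\<^sup>2 / 2) * (- of_real t)) * (of_real Y - \<i> * of_real t) ^ Suc d
        + of_nat (Suc d) * (of_real Y - \<i> * of_real t) ^ d * (- \<i>) * (complex_of_real (1 / sqrt (2 * pi)) * exp (- (of_real t)\<^sup>2 / 2))))
          (at (of_real t))"
        by (rule derivative_eq_intros refl | simp)+
      from has_vector_derivative_real_field[OF this] show ?thesis
        unfolding \<phi> of_real_mult of_real_minus by (simp add: mult_ac)
    qed
    also have "(complex_of_real (- t * std_normal_density t) * (of_real Y - \<i> * of_real t) ^ Suc d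
        + complex_of_real (std_normal_density t) * (of_nat (Suc d) * (of_real Y - \<i> * of_real t) ^ d * (- \<i>))) = f t"
    proof -
      define Z where "Z = of_real Y - \<i> * complex_of_real t"
      have t: "complex_of_real t = \<i> * (Z - of_real Y)" by (simp add: Z_def algebra_simps)
      show ?thesis
        unfolding f_def of_real_mult of_real_minus Z_def[symmetric] t by (simp add: algebra_simps)
    qed
    finally show ?thesis .
  qed
  \<comment> \<open>The boundary terms of the integration by parts vanish.\<close>
  have "(LBINT t=-\<infinity>..\<infinity>. f t) = 0 - 0"
  proof (rule interval_integral_FTC_integrable)
    show "isCont f t" for t
      unfolding f_def std_normal_density_def by (intro continuous_intros) auto
    show "((?I (Suc d) \<circ> real_of_ereal) \<longlongrightarrow> 0) (at_right (-\<infinity>))"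
      "((?I (Suc d) \<circ> real_of_ereal) \<longlongrightarrow> 0) (at_left \<infinity>)"
      unfolding ereal_tendsto_simps1 by (rule gaussian_power_tendsto_0)+
  qed (use deriv int_f in \<open>auto simp: set_integrable_def\<close>)
  then have "0 = (LINT t|lborel. f t)"
    by (simp add: interval_lebesgue_integral_def set_lebesgue_integral_def)
  also have "\<dots> = - \<i> * ((LINT t|lborel. ?I (Suc (Suc d)) t) - of_real Y * (LINT t|lborel. ?I (Suc d) t)
      + of_nat (Suc d) * (LINT t|lborel. ?I d t))"
    unfolding f_def
    by (simp only: integral_mult_right_zero Bochner_Integration.integral_add Bochner_Integration.integral_diff
        integrable_gaussian_power integrable_mult_right Bochner_Integration.integrable_diff)
  finally have "(LINT t|lborel. ?I (Suc (Suc d)) t) - of_real Y * (LINT t|lborel. ?I (Suc d) t)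
      + of_nat (Suc d) * (LINT t|lborel. ?I d t) = 0"
    by (simp only: mult_eq_0_iff neg_equal_0_iff_equal complex_i_not_zero simp_thms eq_commute[of 0])
  then show ?case
    unfolding ge2 by (simp add: hermite_Suc_Suc algebra_simps add_eq_0_iff del: hermite.simps power_Suc)
qed

section \<open>Jensen polynomials as Cauchy integrals\<close>

lemma has_integral_exp_over_period:
  fixes k :: int
  shows "((\<lambda>y. exp (of_int k * Complex s y)) has_integral (if k = 0 then 2 * of_real pi else 0)) {a..a + 2 * pi}"
proof (cases "k = 0")
  case True
  then show ?thesis using has_integral_const_real[of "1 :: complex" a "a + 2 * pi"] by (simp add: scaleR_conv_of_real)
next
  case False
  let ?E = "\<lambda>y. exp (of_int k * Complex s y) / (\<i> * of_int k)"
  have E: "?E y = exp (of_int k * (of_real s + \<i> * of_real y)) / (\<i> * of_int k)" for y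
    by (simp add: Complex_eq)
  have "((\<lambda>y. exp (of_int k * Complex s y)) has_integral ?E (a + 2 * pi) - ?E a) {a..a + 2 * pi}"
  proof (rule fundamental_theorem_of_calculus)
    fix y
    have "((\<lambda>z. exp (of_int k * (of_real s + \<i> * z)) / (\<i> * of_int k))
        has_field_derivative exp (of_int k * (of_real s + \<i> * of_real y))) (at (of_real y))"
      using False by (auto intro!: derivative_eq_intros)
    then have "((\<lambda>y. exp (of_int k * (of_real s + \<i> * of_real y)) / (\<i> * of_int k))
        has_vector_derivative exp (of_int k * (of_real s + \<i> * of_real y))) (at y within {a..a + 2 * pi})"
      by (rule has_vector_derivative_real_field)
    then show "(?E has_vector_derivative exp (of_int k * Complex s y)) (at y within {a..a + 2 * pi})"
      by (simp add: Complex_eq)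
  qed simp
  moreover have "of_int k * Complex s (a + 2 * pi) = of_int k * Complex s a + \<i> * (of_int k * (of_real pi * 2))"
    by (simp add: Complex_eq algebra_simps)
  ultimately show ?thesis using False by (simp only: exp_plus_2pin) simp
qed

text \<open>Cauchy's formula over an arbitrary period \<open>[a, a + 2 \<pi>]\<close>, obtained by integrating the
series term by term. The free starting point \<open>a\<close> lets the period be cut into the major arc and the minor arc.\<close>

lemma power_series_coeff_integral:
  fixes c :: "nat \<Rightarrow> complex"
  assumes conv: "\<And>w. norm w < 1 \<Longrightarrow> summable (\<lambda>m. c m * w ^ m)" and "0 < s"
  shows "((\<lambda>y. (\<Sum>m. c m * exp (- Complex s y) ^ m) * exp (of_nat n * Complex s y))
    has_integral 2 * of_real pi * c n) {a..a + 2 * pi}"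
proof -
  define f where "f m y = c m * exp (- Complex s y) ^ m * exp (of_nat n * Complex s y)" for m y
  have sm: "summable (\<lambda>m. norm (c m * of_real (exp (- s)) ^ m))"
  proof (rule powser_insidea)
    show "summable (\<lambda>m. c m * of_real (exp (- s / 2)) ^ m)"
      using \<open>0 < s\<close> by (intro conv) simp
    show "norm (complex_of_real (exp (- s))) < norm (complex_of_real (exp (- s / 2)))"
      using \<open>0 < s\<close> by simp
  qed
  have nf: "norm (f m y) = norm (c m * of_real (exp (- s)) ^ m) * exp (n * s)" for m y
    by (simp add: f_def norm_mult norm_power)
  have "uniform_limit {a..a + 2 * pi} (\<lambda>N y. \<Sum>m<N. f m y) (\<lambda>y. \<Sum>m. f m y) sequentially"
    by (rule Weierstrass_m_test[where M = "\<lambda>m. norm (c m * of_real (exp (- s)) ^ m) * exp (n * s)"])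
      (simp_all add: nf summable_mult2[OF sm])
  also have "(\<lambda>y. \<Sum>m. f m y) = (\<lambda>y. (\<Sum>m. c m * exp (- Complex s y) ^ m) * exp (of_nat n * Complex s y))"
    unfolding f_def using \<open>0 < s\<close> by (intro ext suminf_mult2[symmetric] conv) simp
  finally have lim: "uniform_limit {a..a + 2 * pi} (\<lambda>N y. \<Sum>m<N. f m y)
     (\<lambda>y. (\<Sum>m. c m * exp (- Complex s y) ^ m) * exp (of_nat n * Complex s y)) sequentially" .
  have f_exp: "f m y = c m * exp (of_int (int n - int m) * Complex s y)" for m y
    unfolding f_def exp_of_nat_mult[symmetric] mult.assoc exp_add[symmetric] by (simp add: algebra_simps)
  have int_f: "((\<lambda>y. \<Sum>m<N. f m y) has_integral (\<Sum>m<N. c m * (if int n - int m = 0 then 2 * of_real pi else 0))) {a..a + 2 * pi}" for N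
    unfolding f_exp by (intro has_integral_sum has_integral_mult_right has_integral_exp_over_period) simp
  have cont: "continuous_on {a..a + 2 * pi} (\<lambda>y. \<Sum>m<N. f m y)" for N
    unfolding f_def Complex_eq by (intro continuous_intros)
  obtain I J where IJ: "\<And>N. ((\<lambda>y. \<Sum>m<N. f m y) has_integral I N) {a..a + 2 * pi}"
    "((\<lambda>y. (\<Sum>m. c m * exp (- Complex s y) ^ m) * exp (of_nat n * Complex s y)) has_integral J) {a..a + 2 * pi}"
    "I \<longlonglongrightarrow> J"
    using uniform_limit_integral[OF lim cont] by auto
  have I_eq: "I N = (if n < N then 2 * of_real pi * c n else 0)" for N
  proof -
    have "I N = (\<Sum>m<N. if m = n then 2 * of_real pi * c m else 0)"
      unfolding has_integral_unique[OF IJ(1) int_f] by (intro sum.cong) auto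
    then show ?thesis by simp
  qed
  have "eventually (\<lambda>N. I N = 2 * of_real pi * c n) sequentially"
    using eventually_gt_at_top[of n] by eventually_elim (simp add: I_eq)
  then have "I \<longlonglongrightarrow> 2 * of_real pi * c n" by (rule tendsto_eventually)
  with IJ(2,3) show ?thesis using LIMSEQ_unique by blast
qed

text \<open>Shifting the index by \<open>j\<close> multiplies the Cauchy integrand by \<open>exp (j w)\<close>, so the binomial sum in the
Jensen polynomial becomes a power under the integral sign.\<close>

lemma jensen_poly_integral:
  assumes conv: "\<And>w. norm w < 1 \<Longrightarrow> summable (\<lambda>m. of_real (C m) * w ^ m :: complex)" and "0 < s"
  shows "((\<lambda>y. (\<Sum>m. of_real (C m) * exp (- Complex s y) ^ m) * exp (of_nat n * Complex s y)
      * (1 + of_real x * exp (Complex s y)) ^ d)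
    has_integral 2 * of_real pi * of_real (poly (jensen_poly C d n) x)) {a..a + 2 * pi}"
proof -
  let ?G = "\<lambda>y. \<Sum>m. complex_of_real (C m) * exp (- Complex s y) ^ m"
  have "((\<lambda>y. \<Sum>j\<le>d. (of_nat (d choose j) * of_real x ^ j) * (?G y * exp (of_nat (n + j) * Complex s y)))
    has_integral (\<Sum>j\<le>d. (of_nat (d choose j) * of_real x ^ j) * (2 * of_real pi * of_real (C (n + j))))) {a..a + 2 * pi}"
    by (intro has_integral_sum has_integral_mult_right power_series_coeff_integral assms) auto
  also have "(\<Sum>j\<le>d. (of_nat (d choose j) * of_real x ^ j) * (2 * of_real pi * of_real (C (n + j))))
      = 2 * of_real pi * complex_of_real (poly (jensen_poly C d n) x)"
    by (simp add: jensen_poly_def poly_sum poly_monom sum_distrib_left mult_ac)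
  also have "(\<lambda>y. \<Sum>j\<le>d. (of_nat (d choose j) * of_real x ^ j) * (?G y * exp (of_nat (n + j) * Complex s y)))
      = (\<lambda>y. ?G y * exp (of_nat n * Complex s y) * (1 + of_real x * exp (Complex s y)) ^ d)"
  proof
    fix y
    have "(1 + of_real x * exp (Complex s y)) ^ d
        = (\<Sum>j\<le>d. of_nat (d choose j) * (of_real x * exp (Complex s y)) ^ j)"
      using binomial_ring[of "of_real x * exp (Complex s y)" 1 d] by (simp add: add.commute)
    moreover have "exp (of_nat (n + j) * Complex s y) = exp (of_nat n * Complex s y) * exp (Complex s y) ^ j" for j
      by (simp only: of_nat_add distrib_right exp_add exp_of_nat_mult)
    ultimately show "(\<Sum>j\<le>d. (of_nat (d choose j) * of_real x ^ j) * (?G y * exp (of_nat (n + j) * Complex s y)))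
      = ?G y * exp (of_nat n * Complex s y) * (1 + of_real x * exp (Complex s y)) ^ d"
      by (simp only: sum_distrib_left power_mult_distrib mult_ac)
  qed
  finally show ?thesis .
qed

section \<open>The integrand near the saddle point\<close>

text \<open>The scale on which the quadratic term of \<open>A / w + (A / s^2) w\<close> at its critical point \<open>w = s\<close> becomes
\<open>- t^2 / 2\<close>.\<close>

definition saddle_width :: "real \<Rightarrow> real \<Rightarrow> real" where
  "saddle_width A s = sqrt (s ^ 3 / (2 * A))"

lemma saddle_width_pos: "0 < A \<Longrightarrow> 0 < s \<Longrightarrow> 0 < saddle_width A s"
  by (simp add: saddle_width_def)

lemma saddle_width_square: "0 < A \<Longrightarrow> 0 < s \<Longrightarrow> (saddle_width A s)\<^sup>2 = s ^ 3 / (2 * A)"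
  by (simp add: saddle_width_def)

lemma saddle_width_tendsto:
  assumes "0 < A"
  shows "(saddle_width A \<longlongrightarrow> 0) (at_right 0)"
    and "((\<lambda>s. saddle_width A s / s) \<longlongrightarrow> 0) (at_right 0)"
  unfolding saddle_width_def using assms by real_asymp+

text \<open>With \<open>z = s u\<close> the exponent is \<open>A / z + A z / s^2 = 2 A / s + (A / s) (u - 1)^2 / u\<close> exactly. The width is chosen
such that \<open>(A / s) (u - 1)^2 = - t^2 / 2\<close>, and \<open>u\<close> tends to \<open>1\<close> for fixed \<open>t\<close>.\<close>

lemma saddle_factorization:
  fixes s t A \<beta> :: real and G :: "complex \<Rightarrow> complex"
  assumes "0 < s" "0 < A"
  defines "y \<equiv> saddle_width A s * t"
  defines "u \<equiv> Complex 1 (y / s)" and "z \<equiv> Complex s y"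
  shows "G z * exp (of_real (A / s\<^sup>2) * z)
    = of_real (s powr \<beta> * exp (2 * A / s)) * (G z / (z powr of_real \<beta> * exp (of_real A / z)))
       * u powr of_real \<beta> * exp (- of_real (t\<^sup>2 / 2) / u)"
proof -
  have z: "z = of_real s * u" using \<open>0 < s\<close> by (simp add: z_def u_def complex_eq_iff)
  have [simp]: "u \<noteq> 0" "z \<noteq> 0" using \<open>0 < s\<close> by (simp_all add: u_def z_def complex_eq_iff)
  have "Ln z = of_real (ln s) + Ln u" unfolding z using \<open>0 < s\<close> by (simp add: Ln_times_of_real Ln_of_real)
  then have pw: "z powr of_real \<beta> = of_real (s powr \<beta>) * u powr of_real \<beta>"
    using \<open>0 < s\<close> by (simp add: powr_def distrib_left exp_add exp_of_real[symmetric])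
  have "(of_real y / of_real s :: complex)\<^sup>2 = of_real (y\<^sup>2 / s\<^sup>2)" by (simp add: power_divide)
  also have "y\<^sup>2 / s\<^sup>2 = s * t\<^sup>2 / (2 * A)"
    unfolding y_def power_mult_distrib saddle_width_square[OF assms(2,1)]
    using assms(1,2) by (simp add: field_simps power3_eq_cube power2_eq_square)
  also have "(of_real y / of_real s :: complex)\<^sup>2 = - (u - 1)\<^sup>2"
    by (simp add: u_def Complex_eq power_mult_distrib power_divide)
  finally have "(u - 1)\<^sup>2 = - of_real (s * t\<^sup>2 / (2 * A))"
    by (metis minus_minus)
  then have "of_real (A / s) * (u - 1)\<^sup>2 = - complex_of_real (A / s * (s * t\<^sup>2 / (2 * A)))"
    by (simp only: of_real_mult mult_minus_right)
  also have "A / s * (s * t\<^sup>2 / (2 * A)) = t\<^sup>2 / 2"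
    using assms(1,2) by simp
  finally have sq: "of_real (A / s) * (u - 1)\<^sup>2 = - complex_of_real (t\<^sup>2 / 2)" .
  have "of_real (A / s\<^sup>2) * z + of_real A / z = of_real (2 * A / s) + of_real (A / s) * (u - 1)\<^sup>2 / u"
    unfolding z using \<open>0 < s\<close> by (simp add: field_simps power2_eq_square)
  then have "of_real (A / s\<^sup>2) * z = of_real (2 * A / s) + - of_real (t\<^sup>2 / 2) / u - of_real A / z"
    unfolding sq by (simp add: eq_diff_eq)
  then have ex: "exp (of_real (A / s\<^sup>2) * z)
      = of_real (exp (2 * A / s)) * exp (- of_real (t\<^sup>2 / 2) / u) / exp (of_real A / z)"
    by (simp only: exp_diff exp_add exp_of_real)
  have "u powr of_real \<beta> \<noteq> 0" by (simp add: powr_def)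
  then show ?thesis
    unfolding ex pw using \<open>0 < s\<close> by (simp add: field_simps)
qed

lemma norm_powr_le_on_strip:
  assumes "\<bar>v\<bar> \<le> M"
  shows "norm (Complex 1 v powr of_real \<beta>) \<le> (1 + M) powr \<bar>\<beta>\<bar>"
proof -
  have "norm (Complex 1 v powr of_real \<beta>) = norm (Complex 1 v) powr \<beta>"
    by (simp add: norm_powr_real_powr')
  also have "\<dots> \<le> norm (Complex 1 v) powr \<bar>\<beta>\<bar>"
    using complex_Re_le_cmod[of "Complex 1 v"] by (intro powr_mono) auto
  also have "\<dots> \<le> (1 + M) powr \<bar>\<beta>\<bar>"
    using cmod_le[of "Complex 1 v"] assms by (intro powr_mono2) auto
  finally show ?thesis .
qed

text \<open>On the whole major arc the integrand keeps a Gaussian bound, because the real part of \<open>1 / (1 + i v)\<close> is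
\<open>1 / (1 + v^2)\<close>. This provides the dominating function.\<close>

lemma norm_gaussian_le_on_strip:
  assumes "\<bar>v\<bar> \<le> M"
  shows "norm (exp (- of_real (t\<^sup>2 / 2) / Complex 1 v)) \<le> exp (- t\<^sup>2 / (2 * (1 + M\<^sup>2)))"
proof -
  have "v\<^sup>2 \<le> M\<^sup>2" using assms by (metis abs_ge_zero power2_abs power_mono)
  have "Re (- of_real a / Complex 1 v) = - a / (1 + v\<^sup>2)" for a
    by (simp add: Re_divide)
  then have "Re (- of_real (t\<^sup>2 / 2) / Complex 1 v) = - (t\<^sup>2 / 2) / (1 + v\<^sup>2)" .
  also have "\<dots> \<le> - (t\<^sup>2 / 2) / (1 + M\<^sup>2)"
    using \<open>v\<^sup>2 \<le> M\<^sup>2\<close> by (simp add: frac_le add_pos_nonneg)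
  finally show ?thesis by (simp add: mult.commute)
qed

lemma jensen_kernel_norm_le:
  assumes "0 < \<delta>"
  shows "norm ((1 - of_real (1 - \<delta> * Y) * exp (\<i> * of_real (\<delta> * t))) / of_real \<delta>) \<le> \<bar>Y\<bar> + \<bar>t\<bar>"
proof -
  have "norm (exp (\<i> * of_real (\<delta> * t)) - 1) \<le> \<bar>\<delta> * t\<bar>"
    using iexp_approx1[of "\<delta> * t" 0] by simp
  have "1 - of_real (1 - \<delta> * Y) * exp (\<i> * of_real (\<delta> * t))
      = of_real (\<delta> * Y) * exp (\<i> * of_real (\<delta> * t)) - (exp (\<i> * of_real (\<delta> * t)) - 1)"
    by (simp add: algebra_simps)
  also have "norm \<dots> \<le> \<delta> * \<bar>Y\<bar> + \<bar>\<delta> * t\<bar>"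
    by (rule order_trans[OF norm_triangle_ineq4 add_mono])
      (use \<open>norm _ \<le> _\<close> assms in \<open>auto simp: norm_mult abs_mult\<close>)
  finally show ?thesis using assms by (simp add: norm_divide field_simps abs_mult)
qed

lemma jensen_kernel_tendsto:
  assumes "\<delta> \<longlonglongrightarrow> 0" "\<And>k. 0 < \<delta> k"
  shows "(\<lambda>k. (1 - of_real (1 - \<delta> k * Y) * exp (\<i> * of_real (\<delta> k * t))) / of_real (\<delta> k))
    \<longlonglongrightarrow> of_real Y - \<i> * of_real t"
proof -
  have "((\<lambda>h. exp (\<i> * of_real t * h)) has_field_derivative \<i> * of_real t) (at 0)"
    by (auto intro!: derivative_eq_intros)
  then have "((\<lambda>h. (exp (\<i> * of_real t * h) - 1) / h) \<longlongrightarrow> \<i> * of_real t) (at 0)"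
    by (simp add: DERIV_def)
  moreover have "filterlim (\<lambda>k. complex_of_real (\<delta> k)) (at 0) sequentially"
    using assms tendsto_of_real[OF assms(1), where ?'a = complex]
    by (auto simp: filterlim_at less_imp_neq[symmetric] intro!: always_eventually less_imp_neq[symmetric])
  ultimately have quot: "(\<lambda>k. (exp (\<i> * of_real t * of_real (\<delta> k)) - 1) / of_real (\<delta> k)) \<longlonglongrightarrow> \<i> * of_real t"
    by (rule filterlim_compose)
  have "(\<lambda>k. of_real Y * exp (\<i> * of_real (\<delta> k * t)) - (exp (\<i> * of_real t * of_real (\<delta> k)) - 1) / of_real (\<delta> k))
      \<longlonglongrightarrow> of_real Y * exp (\<i> * of_real (0 * t)) - \<i> * of_real t"
    by (intro tendsto_intros assms quot)
  also have "(\<lambda>k. of_real Y * exp (\<i> * of_real (\<delta> k * t)) - (exp (\<i> * of_real t * of_real (\<delta> k)) - 1) / of_real (\<delta> k))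
     = (\<lambda>k. (1 - of_real (1 - \<delta> k * Y) * exp (\<i> * of_real (\<delta> k * t))) / of_real (\<delta> k))"
    using assms(2) by (auto simp: fun_eq_iff field_simps less_imp_neq[symmetric])
  finally show ?thesis by simp
qed

lemma integrable_abs_power_times_gaussian:
  assumes "0 < \<sigma>"
  shows "integrable lborel (\<lambda>t::real. (\<bar>Y\<bar> + \<bar>t\<bar>) ^ d * exp (- t\<^sup>2 / (2 * \<sigma>\<^sup>2)))"
proof -
  have "integrable lborel (\<lambda>t. \<Sum>k\<le>d. (of_nat (d choose k) * \<bar>Y\<bar> ^ (d - k) * sqrt (2 * pi * \<sigma>\<^sup>2))
      * (normal_density 0 \<sigma> t * \<bar>t - 0\<bar> ^ k))"
    by (intro Bochner_Integration.integrable_sum integrable_mult_right integrable_normal_moment_abs assms)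
  also have "(\<lambda>t. \<Sum>k\<le>d. (of_nat (d choose k) * \<bar>Y\<bar> ^ (d - k) * sqrt (2 * pi * \<sigma>\<^sup>2))
      * (normal_density 0 \<sigma> t * \<bar>t - 0\<bar> ^ k)) = (\<lambda>t. (\<bar>Y\<bar> + \<bar>t\<bar>) ^ d * exp (- t\<^sup>2 / (2 * \<sigma>\<^sup>2)))"
  proof
    fix t :: real
    have "(\<bar>Y\<bar> + \<bar>t\<bar>) ^ d = (\<Sum>k\<le>d. of_nat (d choose k) * \<bar>t\<bar> ^ k * \<bar>Y\<bar> ^ (d - k))"
      using binomial_ring[of "\<bar>t\<bar>" "\<bar>Y\<bar>" d] by (simp add: add.commute)
    then show "(\<Sum>k\<le>d. (of_nat (d choose k) * \<bar>Y\<bar> ^ (d - k) * sqrt (2 * pi * \<sigma>\<^sup>2))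
      * (normal_density 0 \<sigma> t * \<bar>t - 0\<bar> ^ k)) = (\<bar>Y\<bar> + \<bar>t\<bar>) ^ d * exp (- t\<^sup>2 / (2 * \<sigma>\<^sup>2))"
      using assms by (simp add: normal_density_def sum_distrib_right sum_distrib_left mult_ac)
  qed
  finally show ?thesis .
qed

text \<open>The integrand of \<open>jensen_poly_integral\<close> for \<open>n = A / s^2\<close>, at the argument
\<open>- exp (- s) * (1 - \<delta> * Y)\<close> of the Jensen polynomial, where \<open>\<delta>\<close> is the saddle width.\<close>

definition saddle_integrand :: "(complex \<Rightarrow> complex) \<Rightarrow> real \<Rightarrow> nat \<Rightarrow> real \<Rightarrow> real \<Rightarrow> real \<Rightarrow> complex" where
  "saddle_integrand G A d Y s y = G (Complex s y) * exp (of_real (A / s\<^sup>2) * Complex s y)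
     * (1 - of_real (1 - saddle_width A s * Y) * exp (\<i> * of_real y)) ^ d"

text \<open>The size of the integral of \<open>saddle_integrand\<close>: one factor \<open>\<delta>\<close> is the length of the peak, the other \<open>d\<close>
come from the Jensen factor, and the rest is the size of \<open>G w * exp (n * w)\<close> at \<open>w = s\<close>.\<close>

definition saddle_scale :: "real \<Rightarrow> real \<Rightarrow> nat \<Rightarrow> real \<Rightarrow> real" where
  "saddle_scale A \<beta> d s = saddle_width A s ^ Suc d * s powr \<beta> * exp (2 * A / s)"

lemma saddle_scale_pos: "0 < A \<Longrightarrow> 0 < s \<Longrightarrow> 0 < saddle_scale A \<beta> d s"
  by (simp add: saddle_scale_def saddle_width_pos)

lemma continuous_on_saddle_integrand:
  assumes "continuous_on {w. 0 < Re w} G" "0 < s"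
  shows "continuous_on S (saddle_integrand G A d Y s)"
proof -
  have "continuous_on S (\<lambda>y. G (Complex s y))"
    by (rule continuous_on_compose2[OF assms(1)]) (use assms(2) in \<open>auto simp: Complex_eq intro!: continuous_intros\<close>)
  then show ?thesis
    unfolding saddle_integrand_def Complex_eq by (intro continuous_intros)
qed

lemma saddle_integrand_rescaled:
  assumes "0 < s" "0 < A"
  defines "\<delta> \<equiv> saddle_width A s"
  shows "of_real (\<delta> / saddle_scale A \<beta> d s) * saddle_integrand G A d Y s (\<delta> * t)
    = (G (Complex s (\<delta> * t)) / (Complex s (\<delta> * t) powr of_real \<beta> * exp (of_real A / Complex s (\<delta> * t))))
      * Complex 1 (\<delta> * t / s) powr of_real \<beta>
      * exp (- of_real (t\<^sup>2 / 2) / Complex 1 (\<delta> * t / s))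
      * ((1 - of_real (1 - \<delta> * Y) * exp (\<i> * of_real (\<delta> * t))) / of_real \<delta>) ^ d"
proof -
  have "0 < \<delta>" using assms saddle_width_pos by simp
  then show ?thesis
    unfolding saddle_integrand_def saddle_scale_def \<delta>_def[symmetric]
    using saddle_factorization[OF assms(1,2), of G t \<beta>, folded \<delta>_def] \<open>0 < s\<close>
    by (simp add: field_simps power_divide)
qed

text \<open>Substituting \<open>y = \<delta> t\<close> blows the peak up to unit scale. The rescaled integrands converge pointwise to
\<open>\<alpha> exp(- t^2 / 2) (Y - i t)^d\<close>; on the arc they are dominated by a polynomial times a
Gaussian of larger variance, and outside they vanish.\<close>

lemma major_arc_limit:
  fixes s :: "nat \<Rightarrow> real"
  assumes "0 < A" "0 < M" and s: "\<And>k. 0 < s k" "s \<longlonglongrightarrow> 0"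
    and cont: "continuous_on {w. 0 < Re w} G"
    and lim: "((\<lambda>w. G w / (w powr of_real \<beta> * exp (of_real A / w))) \<longlongrightarrow> \<alpha>) (at 0 within major_cone M)"
  shows "(\<lambda>k. integral {- M * s k..M * s k} (saddle_integrand G A d Y (s k)) / of_real (saddle_scale A \<beta> d (s k)))
    \<longlonglongrightarrow> \<alpha> * of_real (sqrt (2 * pi) * poly (hermite d) Y)"
proof -
  define \<delta> where "\<delta> k = saddle_width A (s k)" for k
  define ratio where "ratio w = G w / (w powr of_real \<beta> * exp (of_real A / w))" for w
  define z where "z k t = Complex (s k) (\<delta> k * t)" for k t
  define \<phi> where "\<phi> k t = indicator {- M * s k..M * s k} (\<delta> k * t) *\<^sub>R
      (of_real (\<delta> k / saddle_scale A \<beta> d (s k)) * saddle_integrand G A d Y (s k) (\<delta> k * t))" for k t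
  have \<delta>_pos: "0 < \<delta> k" for k by (simp add: \<delta>_def saddle_width_pos s \<open>0 < A\<close>)
  have s_at: "filterlim s (at_right 0) sequentially"
    using s by (simp add: filterlim_at less_imp_neq[THEN not_sym])
  have \<delta>_0: "\<delta> \<longlonglongrightarrow> 0" and v_0: "(\<lambda>k. \<delta> k / s k) \<longlonglongrightarrow> 0"
    unfolding \<delta>_def
    using filterlim_compose[OF saddle_width_tendsto(1)[OF \<open>0 < A\<close>] s_at]
      filterlim_compose[OF saddle_width_tendsto(2)[OF \<open>0 < A\<close>] s_at] by (simp_all add: o_def)
  have \<phi>_eq: "\<phi> k t = ratio (z k t) * Complex 1 (\<delta> k * t / s k) powr of_real \<beta>
      * exp (- of_real (t\<^sup>2 / 2) / Complex 1 (\<delta> k * t / s k))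
      * ((1 - of_real (1 - \<delta> k * Y) * exp (\<i> * of_real (\<delta> k * t))) / of_real (\<delta> k)) ^ d"
    if "\<bar>\<delta> k * t\<bar> \<le> M * s k" for k t
  proof -
    have "\<delta> k * t \<in> {- M * s k..M * s k}" using that by (auto simp: abs_le_iff)
    then show ?thesis
      unfolding \<phi>_def \<delta>_def ratio_def z_def
      by (simp only: saddle_integrand_rescaled[OF s(1) \<open>0 < A\<close>] indicator_simps scaleR_one)
  qed
  have int_eq: "integral {- M * s k..M * s k} (saddle_integrand G A d Y (s k)) / of_real (saddle_scale A \<beta> d (s k))
      = (LINT t|lborel. \<phi> k t)" for k
  proof -
    have "set_integrable lborel {- M * s k..M * s k} (saddle_integrand G A d Y (s k))"
      by (intro borel_integrable_atLeastAtMost' continuous_on_saddle_integrand cont s)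
    from set_borel_integral_eq_integral(2)[OF this]
    have "integral {- M * s k..M * s k} (saddle_integrand G A d Y (s k))
        = (LINT y|lborel. indicator {- M * s k..M * s k} y *\<^sub>R saddle_integrand G A d Y (s k) y)"
      by (simp add: set_lebesgue_integral_def)
    also have "\<dots> = \<delta> k *\<^sub>R (LINT t|lborel. indicator {- M * s k..M * s k} (\<delta> k * t) *\<^sub>R saddle_integrand G A d Y (s k) (\<delta> k * t))"
      using lborel_integral_real_affine[of "\<delta> k" "\<lambda>y. indicator {- M * s k..M * s k} y *\<^sub>R saddle_integrand G A d Y (s k) y" 0] \<delta>_pos[of k]
      by simp
    finally show ?thesis
      unfolding \<phi>_def by (simp add: scaleR_conv_of_real mult.left_commute[of "of_real (indicator _ _)"])
  qed
  obtain \<epsilon> where \<epsilon>: "0 < \<epsilon>" "\<And>w. w \<in> major_cone M \<Longrightarrow> norm w < \<epsilon> \<Longrightarrow> norm (ratio w) \<le> norm \<alpha> + 1"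
  proof -
    have "eventually (\<lambda>w. norm (ratio w) < norm \<alpha> + 1) (at 0 within major_cone M)"
      using order_tendstoD(2)[OF tendsto_norm[OF lim], of "norm \<alpha> + 1"] by (simp add: ratio_def)
    then obtain \<epsilon> where "0 < \<epsilon>" "\<And>w. w \<in> major_cone M \<Longrightarrow> w \<noteq> 0 \<Longrightarrow> dist w 0 < \<epsilon> \<Longrightarrow> norm (ratio w) < norm \<alpha> + 1"
      by (auto simp: eventually_at)
    then show ?thesis
      by (intro that[of \<epsilon>]) (force simp: major_cone_def intro: less_imp_le)+
  qed
  have cone: "z k t \<in> major_cone M" and norm_z: "norm (z k t) \<le> (1 + M) * s k"
    if "\<bar>\<delta> k * t\<bar> \<le> M * s k" for k t
    using that s(1)[of k] cmod_le[of "z k t"] by (auto simp: z_def major_cone_def algebra_simps)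
  have v_le: "\<bar>\<delta> k * t / s k\<bar> \<le> M" if "\<bar>\<delta> k * t\<bar> \<le> M * s k" for k t
    using that s(1)[of k] by (simp add: abs_mult field_simps)
  have "(\<lambda>k. (1 + M) * s k) \<longlonglongrightarrow> (1 + M) * 0" by (intro tendsto_intros s)
  then have "eventually (\<lambda>k. (1 + M) * s k < \<epsilon>) sequentially"
    using \<epsilon>(1) by (auto dest: order_tendstoD(2))
  then obtain k0 where k0: "\<And>k. k0 \<le> k \<Longrightarrow> (1 + M) * s k < \<epsilon>"
    by (auto simp: eventually_sequentially)
  \<comment> \<open>The standard deviation of the dominating Gaussian.\<close>
  define \<sigma> where "\<sigma> = sqrt (1 + M\<^sup>2)"
  have \<sigma>: "0 < \<sigma>" "\<sigma>\<^sup>2 = 1 + M\<^sup>2" by (simp_all add: \<sigma>_def add_pos_nonneg)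
  define h where "h t = ((norm \<alpha> + 1) * (1 + M) powr \<bar>\<beta>\<bar>) * ((\<bar>Y\<bar> + \<bar>t\<bar>) ^ d * exp (- t\<^sup>2 / (2 * \<sigma>\<^sup>2)))" for t
  have bound: "norm (\<phi> k t) \<le> h t" if "k0 \<le> k" for k t
  proof (cases "\<bar>\<delta> k * t\<bar> \<le> M * s k")
    case True
    have "norm (\<phi> k t) \<le> (norm \<alpha> + 1) * (1 + M) powr \<bar>\<beta>\<bar> * exp (- t\<^sup>2 / (2 * (1 + M\<^sup>2))) * (\<bar>Y\<bar> + \<bar>t\<bar>) ^ d"
      unfolding \<phi>_eq[OF True] norm_mult norm_power
      using v_le[OF True] cone[OF True] norm_z[OF True] k0[OF that] \<delta>_pos
      by (intro mult_mono power_mono norm_powr_le_on_strip norm_gaussian_le_on_strip jensen_kernel_norm_le \<epsilon>(2))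
        (auto intro: mult_nonneg_nonneg)
    then show ?thesis by (simp add: h_def \<sigma> mult_ac)
  next
    case False
    then have "\<delta> k * t \<notin> {- M * s k..M * s k}" by (auto simp: abs_le_iff)
    then have "\<phi> k t = 0" by (simp add: \<phi>_def)
    then show ?thesis by (simp add: h_def)
  qed
  have ptw: "(\<lambda>k. \<phi> k t) \<longlonglongrightarrow> \<alpha> * (of_real (exp (- t\<^sup>2 / 2)) * (of_real Y - \<i> * of_real t) ^ d)" for t
  proof -
    have v: "(\<lambda>k. \<delta> k * t / s k) \<longlonglongrightarrow> 0"
      using tendsto_mult_right[OF v_0, of t] by simp
    then have u: "(\<lambda>k. Complex 1 (\<delta> k * t / s k)) \<longlonglongrightarrow> 1"
      using tendsto_Complex[OF tendsto_const[of 1] v] by (simp add: one_complex.code[symmetric])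
    have "eventually (\<lambda>k. \<bar>\<delta> k * t / s k\<bar> < M) sequentially"
      using order_tendstoD(2)[OF tendsto_rabs_zero[OF v] \<open>0 < M\<close>] .
    then have ev: "eventually (\<lambda>k. \<bar>\<delta> k * t\<bar> \<le> M * s k) sequentially"
      by eventually_elim (simp add: abs_mult abs_of_pos[OF s(1)] pos_divide_less_eq[OF s(1)])
    have "filterlim (\<lambda>k. z k t) (at 0 within major_cone M) sequentially"
      unfolding filterlim_at
    proof
      have "z k t \<noteq> 0" for k using s(1)[of k] by (auto simp: z_def complex_eq_iff)
      then show "eventually (\<lambda>k. z k t \<in> major_cone M \<and> z k t \<noteq> 0) sequentially"
        using ev by (auto elim: eventually_mono intro: cone)
      have "(\<lambda>k. Complex (s k) (\<delta> k * t)) \<longlonglongrightarrow> Complex 0 (0 * t)"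
        by (intro tendsto_Complex tendsto_intros s \<delta>_0)
      then show "(\<lambda>k. z k t) \<longlonglongrightarrow> 0" by (simp add: z_def zero_complex.code[symmetric])
    qed
    then have "(\<lambda>k. ratio (z k t)) \<longlonglongrightarrow> \<alpha>"
      using filterlim_compose lim unfolding ratio_def by blast
    then have "(\<lambda>k. ratio (z k t) * Complex 1 (\<delta> k * t / s k) powr of_real \<beta>
      * exp (- of_real (t\<^sup>2 / 2) / Complex 1 (\<delta> k * t / s k))
      * ((1 - of_real (1 - \<delta> k * Y) * exp (\<i> * of_real (\<delta> k * t))) / of_real (\<delta> k)) ^ d)
      \<longlonglongrightarrow> \<alpha> * 1 powr of_real \<beta> * exp (- of_real (t\<^sup>2 / 2) / 1) * (of_real Y - \<i> * of_real t) ^ d"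
      by (intro tendsto_mult tendsto_power tendsto_exp tendsto_divide tendsto_const u jensen_kernel_tendsto \<delta>_0 \<delta>_pos
          tendsto_powr_complex) auto
    then have "(\<lambda>k. \<phi> k t) \<longlonglongrightarrow> \<alpha> * 1 powr of_real \<beta> * exp (- of_real (t\<^sup>2 / 2) / 1) * (of_real Y - \<i> * of_real t) ^ d"
      by (rule Lim_transform_eventually) (use ev in eventually_elim, simp add: \<phi>_eq)
    moreover have "exp (- of_real (t\<^sup>2 / 2) / 1) = complex_of_real (exp (- t\<^sup>2 / 2))"
      by (simp add: exp_of_real[symmetric])
    ultimately show ?thesis by (simp add: mult.assoc)
  qed
  have "(\<lambda>k. LINT t|lborel. \<phi> (k + k0) t) \<longlonglongrightarrow> (LINT t|lborel. \<alpha> * (of_real (exp (- t\<^sup>2 / 2)) * (of_real Y - \<i> * of_real t) ^ d))"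
  proof (rule integral_dominated_convergence[where w = h])
    show "integrable lborel h"
      unfolding h_def by (intro integrable_mult_right integrable_abs_power_times_gaussian \<sigma>)
    have "continuous_on UNIV (\<lambda>t. \<alpha> * (of_real (exp (- t\<^sup>2 / 2)) * (of_real Y - \<i> * of_real t) ^ d))"
      by (intro continuous_intros) auto
    then show "(\<lambda>t. \<alpha> * (of_real (exp (- t\<^sup>2 / 2)) * (of_real Y - \<i> * of_real t) ^ d)) \<in> borel_measurable lborel"
      by (simp add: borel_measurable_continuous_onI)
    show "\<phi> (k + k0) \<in> borel_measurable lborel" for k
    proof -
      have "saddle_integrand G A d Y (s (k + k0)) \<in> borel_measurable borel"
        by (intro borel_measurable_continuous_onI continuous_on_saddle_integrand cont s)
      then show ?thesis unfolding \<phi>_def by measurable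
    qed
    show "AE t in lborel. (\<lambda>k. \<phi> (k + k0) t) \<longlonglongrightarrow> \<alpha> * (of_real (exp (- t\<^sup>2 / 2)) * (of_real Y - \<i> * of_real t) ^ d)"
      using LIMSEQ_ignore_initial_segment[OF ptw] by simp
    show "AE t in lborel. norm (\<phi> (k + k0) t) \<le> h t" for k
      using bound by simp
  qed
  then have "(\<lambda>k. LINT t|lborel. \<phi> k t) \<longlonglongrightarrow> (LINT t|lborel. \<alpha> * (of_real (exp (- t\<^sup>2 / 2)) * (of_real Y - \<i> * of_real t) ^ d))"
    by (rule LIMSEQ_offset)
  also have "(\<lambda>t. \<alpha> * (of_real (exp (- t\<^sup>2 / 2)) * (of_real Y - \<i> * of_real t) ^ d))
     = (\<lambda>t. \<alpha> * of_real (sqrt (2 * pi)) * (of_real (std_normal_density t) * (of_real Y - \<i> * of_real t) ^ d))"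
    by (simp add: std_normal_density_def fun_eq_iff)
  finally show ?thesis
    unfolding int_eq by (simp add: integral_gaussian_power mult.assoc)
qed

section \<open>Convergence of Jensen polynomials to Hermite polynomials\<close>

text \<open>Compared with the saddle point the integrand loses the factor \<open>exp (- \<kappa> / s)\<close>, which beats every
power of \<open>s\<close> in the scale.\<close>

lemma minor_arc_limit:
  fixes s :: "nat \<Rightarrow> real"
  assumes "0 < A" "0 < M" "0 < \<kappa>" and s: "\<And>k. 0 < s k" "s \<longlonglongrightarrow> 0"
    and cont: "continuous_on {w. 0 < Re w} G"
    and minor: "eventually (\<lambda>x. \<forall>y\<in>{M * x..2 * pi - M * x}. norm (G (Complex x y)) \<le> L * exp ((A - \<kappa>) / x)) (at_right 0)"
  shows "(\<lambda>k. integral {M * s k..2 * pi - M * s k} (saddle_integrand G A d Y (s k)) / of_real (saddle_scale A \<beta> d (s k)))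
    \<longlonglongrightarrow> 0"
proof -
  have s_at: "filterlim s (at_right 0) sequentially"
    using s by (simp add: filterlim_at less_imp_neq[THEN not_sym])
  have "((\<lambda>x. 2 * pi * \<bar>L\<bar> * (2 + \<bar>Y\<bar>) ^ d * exp ((2 * A - \<kappa>) / x) / saddle_scale A \<beta> d x) \<longlongrightarrow> 0) (at_right 0)"
  proof -
    have "((\<lambda>x. exp (- \<kappa> / x) / (sqrt (x ^ 3 / (2 * A)) ^ Suc d * x powr \<beta>)) \<longlongrightarrow> 0) (at_right 0)"
      using \<open>0 < \<kappa>\<close> \<open>0 < A\<close> by real_asymp
    from tendsto_mult_right_zero[OF this, of "2 * pi * \<bar>L\<bar> * (2 + \<bar>Y\<bar>) ^ d"] show ?thesis
      by (simp add: saddle_scale_def saddle_width_def diff_divide_distrib exp_diff exp_minus field_simps)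
  qed
  from filterlim_compose[OF this s_at]
  have "(\<lambda>k. 2 * pi * \<bar>L\<bar> * (2 + \<bar>Y\<bar>) ^ d * exp ((2 * A - \<kappa>) / s k) / saddle_scale A \<beta> d (s k)) \<longlonglongrightarrow> 0" .
  moreover have "eventually (\<lambda>k. norm (integral {M * s k..2 * pi - M * s k} (saddle_integrand G A d Y (s k)) / of_real (saddle_scale A \<beta> d (s k)))
     \<le> 2 * pi * \<bar>L\<bar> * (2 + \<bar>Y\<bar>) ^ d * exp ((2 * A - \<kappa>) / s k) / saddle_scale A \<beta> d (s k)) sequentially"
  proof -
    have "eventually (\<lambda>x. M * x < pi) (at_right 0)"
      using \<open>0 < M\<close> by real_asymp
    moreover have "eventually (\<lambda>x. saddle_width A x < 1) (at_right 0)"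
      using order_tendstoD(2)[OF saddle_width_tendsto(1)[OF \<open>0 < A\<close>], of 1] by simp
    ultimately have "eventually (\<lambda>x. M * x < pi \<and> saddle_width A x < 1 \<and>
       (\<forall>y\<in>{M * x..2 * pi - M * x}. norm (G (Complex x y)) \<le> L * exp ((A - \<kappa>) / x))) (at_right 0)"
      using minor by eventually_elim auto
    from eventually_compose_filterlim[OF this s_at] show ?thesis
    proof eventually_elim
      case (elim k)
      define \<delta> where "\<delta> = saddle_width A (s k)"
      have \<delta>: "0 < \<delta>" "\<delta> < 1" using elim saddle_width_pos s \<open>0 < A\<close> by (auto simp: \<delta>_def)
      have "norm (saddle_integrand G A d Y (s k) y) \<le> \<bar>L\<bar> * (2 + \<bar>Y\<bar>) ^ d * exp ((2 * A - \<kappa>) / s k)"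
        if "y \<in> {M * s k..2 * pi - M * s k}" for y
      proof -
        have "norm (1 - of_real (1 - \<delta> * Y) * exp (\<i> * of_real y)) \<le> 1 + \<bar>1 - \<delta> * Y\<bar>"
          by (rule order_trans[OF norm_triangle_ineq4]) (simp add: norm_mult del: of_real_diff of_real_mult)
        also have "\<dots> \<le> 2 + \<bar>Y\<bar>"
          using abs_triangle_ineq4[of 1 "\<delta> * Y"] mult_right_mono[of \<delta> 1 "\<bar>Y\<bar>"] \<delta> by (simp add: abs_mult)
        finally have kernel: "norm (1 - of_real (1 - \<delta> * Y) * exp (\<i> * of_real y)) \<le> 2 + \<bar>Y\<bar>" .
        have "norm (G (Complex (s k) y)) \<le> L * exp ((A - \<kappa>) / s k)" using elim that by blast
        also have "\<dots> \<le> \<bar>L\<bar> * exp ((A - \<kappa>) / s k)" by (intro mult_right_mono) auto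
        finally have G: "norm (G (Complex (s k) y)) \<le> \<bar>L\<bar> * exp ((A - \<kappa>) / s k)" .
        have "norm (exp (of_real (A / (s k)\<^sup>2) * Complex (s k) y)) = exp (A / s k)"
          using s(1)[of k] by (simp add: power2_eq_square)
        then have "norm (saddle_integrand G A d Y (s k) y)
            \<le> (\<bar>L\<bar> * exp ((A - \<kappa>) / s k)) * exp (A / s k) * (2 + \<bar>Y\<bar>) ^ d"
          unfolding saddle_integrand_def norm_mult norm_power \<delta>_def[symmetric]
          using G kernel by (intro mult_mono power_mono) auto
        also have "\<dots> = \<bar>L\<bar> * (2 + \<bar>Y\<bar>) ^ d * exp ((A - \<kappa>) / s k + A / s k)"
          by (simp add: exp_add)
        also have "(A - \<kappa>) / s k + A / s k = (2 * A - \<kappa>) / s k" by (simp add: diff_divide_distrib)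
        finally show ?thesis .
      qed
      then have "norm (integral {M * s k..2 * pi - M * s k} (saddle_integrand G A d Y (s k)))
          \<le> \<bar>L\<bar> * (2 + \<bar>Y\<bar>) ^ d * exp ((2 * A - \<kappa>) / s k) * (2 * pi - M * s k - M * s k)"
        using elim by (intro integral_bound continuous_on_saddle_integrand cont s) auto
      also have "\<dots> \<le> \<bar>L\<bar> * (2 + \<bar>Y\<bar>) ^ d * exp ((2 * A - \<kappa>) / s k) * (2 * pi)"
        using \<open>0 < M\<close> s(1)[of k] by (intro mult_left_mono) auto
      finally show ?case
        using saddle_scale_pos[OF \<open>0 < A\<close> s(1), of \<beta> d k]
        by (simp add: norm_divide divide_right_mono mult_ac)
    qed
  qed
  ultimately show ?thesis by (rule Lim_null_comparison[rotated])
qed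

lemma continuous_on_power_series_exp:
  fixes c :: "nat \<Rightarrow> complex"
  assumes conv: "\<And>w. norm w < 1 \<Longrightarrow> summable (\<lambda>m. c m * w ^ m)"
  shows "continuous_on {w. 0 < Re w} (\<lambda>w. \<Sum>m. c m * exp (- w) ^ m)"
proof -
  have "isCont (\<lambda>q. \<Sum>m. c m * q ^ m) q" if "norm q < 1" for q
  proof (rule isCont_powser)
    show "summable (\<lambda>m. c m * of_real ((norm q + 1) / 2) ^ m)"
      using that by (intro conv) (simp add: norm_divide del: of_real_divide of_real_add)
    show "norm q < norm (complex_of_real ((norm q + 1) / 2))"
      using that by (simp del: of_real_divide of_real_add)
  qed
  then have "continuous_on {q. norm q < 1} (\<lambda>q. \<Sum>m. c m * q ^ m)"
    by (intro continuous_at_imp_continuous_on) auto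
  then show ?thesis
    by (rule continuous_on_compose2) (auto intro!: continuous_intros)
qed

text \<open>The affine coordinate \<open>Y\<close> resolves the roots of the Jensen polynomial, which cluster near \<open>- 1\<close>: in this
coordinate they tend to the roots of the Hermite polynomial.\<close>

definition jensen_point :: "real \<Rightarrow> nat \<Rightarrow> real \<Rightarrow> real" where
  "jensen_point A n Y = - exp (- sqrt (A / n)) * (1 - saddle_width A (sqrt (A / n)) * Y)"

text \<open>The period is cut at \<open>y = M s\<close> into the peak and the minor arc, and only the peak survives in the limit.\<close>

lemma jensen_poly_tendsto_hermite:
  fixes C :: "nat \<Rightarrow> real"
  assumes conv: "\<And>w. norm w < 1 \<Longrightarrow> summable (\<lambda>m. of_real (C m) * w ^ m :: complex)"
    and "0 < A" "0 < M" "0 < \<kappa>"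
  defines "G \<equiv> (\<lambda>w. \<Sum>m. of_real (C m) * exp (- w) ^ m :: complex)"
  assumes lim: "((\<lambda>w. G w / (w powr of_real \<beta> * exp (of_real A / w))) \<longlongrightarrow> \<alpha>) (at 0 within major_cone M)"
    and minor: "eventually (\<lambda>x. \<forall>y\<in>{M * x..2 * pi - M * x}. norm (G (Complex x y)) \<le> L * exp ((A - \<kappa>) / x)) (at_right 0)"
  shows "(\<lambda>n. complex_of_real (2 * pi * poly (jensen_poly C d n) (jensen_point A n Y) / saddle_scale A \<beta> d (sqrt (A / n))))
    \<longlonglongrightarrow> \<alpha> * of_real (sqrt (2 * pi) * poly (hermite d) Y)"
proof (rule LIMSEQ_offset[where k = 1])
  define s where "s k = sqrt (A / real (k + 1))" for k
  have s: "0 < s k" for k using \<open>0 < A\<close> by (simp add: s_def)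
  have s_0: "s \<longlonglongrightarrow> 0" unfolding s_def using \<open>0 < A\<close> by real_asymp
  have cont: "continuous_on {w. 0 < Re w} G"
    unfolding G_def by (rule continuous_on_power_series_exp[OF conv])
  let ?I = "\<lambda>a b k. integral {a..b} (saddle_integrand G A d Y (s k)) / of_real (saddle_scale A \<beta> d (s k))"
  have "(\<lambda>k. ?I (- M * s k) (M * s k) k + ?I (M * s k) (2 * pi - M * s k) k)
      \<longlonglongrightarrow> \<alpha> * of_real (sqrt (2 * pi) * poly (hermite d) Y) + 0"
    by (intro tendsto_add major_arc_limit[where M = M] minor_arc_limit[where M = M and \<kappa> = \<kappa> and L = L]) fact+
  moreover have "eventually (\<lambda>k. ?I (- M * s k) (M * s k) k + ?I (M * s k) (2 * pi - M * s k) k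
      = complex_of_real (2 * pi * poly (jensen_poly C d (k + 1)) (jensen_point A (k + 1) Y) / saddle_scale A \<beta> d (s k))) sequentially"
  proof -
    have "(\<lambda>k. M * s k) \<longlonglongrightarrow> M * 0" by (intro tendsto_intros s_0)
    then have "eventually (\<lambda>k. M * s k < pi) sequentially"
      by (rule order_tendstoD(2)) simp
    then show ?thesis
    proof eventually_elim
      case (elim k)
      have "0 < M * s k" using s \<open>0 < M\<close> by simp
      have "1 + of_real (jensen_point A (k + 1) Y) * exp (Complex (s k) y)
          = 1 - of_real (1 - saddle_width A (s k) * Y) * exp (\<i> * of_real y)" for y
      proof -
        have "exp (Complex (s k) y) = of_real (exp (s k)) * exp (\<i> * of_real y)"
          by (simp add: Complex_eq exp_add exp_of_real)
        moreover have "jensen_point A (k + 1) Y = - exp (- s k) * (1 - saddle_width A (s k) * Y)"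
          by (simp add: jensen_point_def s_def)
        then have "jensen_point A (k + 1) Y * exp (s k) = - (1 - saddle_width A (s k) * Y)"
          by (simp add: exp_minus field_simps)
        ultimately show ?thesis
          by (metis (no_types, lifting) add_uminus_conv_diff mult.assoc mult_minus_left of_real_minus of_real_mult)
      qed
      moreover have "of_real (A / (s k)\<^sup>2) = (of_nat (k + 1) :: complex)"
        using \<open>0 < A\<close> by (simp add: s_def)
      ultimately have "(saddle_integrand G A d Y (s k) has_integral
          2 * of_real pi * of_real (poly (jensen_poly C d (k + 1)) (jensen_point A (k + 1) Y))) {- M * s k..- M * s k + 2 * pi}"
        using jensen_poly_integral[OF conv s, of k "k + 1" "jensen_point A (k + 1) Y" d "- M * s k"]
        unfolding saddle_integrand_def[abs_def] G_def by simp
      then have "integral {- M * s k..2 * pi - M * s k} (saddle_integrand G A d Y (s k))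
          = 2 * of_real pi * of_real (poly (jensen_poly C d (k + 1)) (jensen_point A (k + 1) Y))"
        by (simp add: integral_unique algebra_simps)
      moreover have "integral {- M * s k..M * s k} (saddle_integrand G A d Y (s k))
          + integral {M * s k..2 * pi - M * s k} (saddle_integrand G A d Y (s k))
          = integral {- M * s k..2 * pi - M * s k} (saddle_integrand G A d Y (s k))"
        using elim \<open>0 < M * s k\<close>
        by (intro Henstock_Kurzweil_Integration.integral_combine integrable_continuous_real continuous_on_saddle_integrand cont s) auto
      ultimately show ?case
        by (simp add: add_divide_distrib[symmetric])
    qed
  qed
  ultimately show "(\<lambda>k. complex_of_real (2 * pi * poly (jensen_poly C d (k + 1)) (jensen_point A (k + 1) Y) / saddle_scale A \<beta> d (sqrt (A / real (k + 1)))))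
      \<longlonglongrightarrow> \<alpha> * of_real (sqrt (2 * pi) * poly (hermite d) Y)"
    unfolding s_def[symmetric] by (simp add: Lim_transform_eventually)
qed

text \<open>The case \<open>K = 1\<close> of the theorem, with the major-arc expansion reduced to its leading term.\<close>

lemma turan_inequalities_of_saddle_asymptotics:
  fixes C :: "nat \<Rightarrow> real"
  assumes conv: "\<And>w. norm w < 1 \<Longrightarrow> summable (\<lambda>m. of_real (C m) * w ^ m :: complex)"
    and "0 < A" "0 < M" "0 < \<kappa>" "\<alpha> \<noteq> 0"
  defines "G \<equiv> (\<lambda>w. \<Sum>m. of_real (C m) * exp (- w) ^ m :: complex)"
  assumes lim: "((\<lambda>w. G w / (w powr of_real \<beta> * exp (of_real A / w))) \<longlongrightarrow> \<alpha>) (at 0 within major_cone M)"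
    and minor: "eventually (\<lambda>x. \<forall>y\<in>{M * x..2 * pi - M * x}. norm (G (Complex x y)) \<le> L * exp ((A - \<kappa>) / x)) (at_right 0)"
  shows "eventually (\<lambda>n. turan_inequalities C d n) sequentially"
proof -
  define r where "r d n Y = 2 * pi * poly (jensen_poly C d n) (jensen_point A n Y) / saddle_scale A \<beta> d (sqrt (A / n))"
    for d n Y
  have r: "(\<lambda>n. complex_of_real (r d n Y)) \<longlonglongrightarrow> \<alpha> * of_real (sqrt (2 * pi) * poly (hermite d) Y)" for d Y
    unfolding r_def
    by (rule jensen_poly_tendsto_hermite[OF conv \<open>0 < A\<close> \<open>0 < M\<close> \<open>0 < \<kappa>\<close>
          lim[unfolded G_def] minor[unfolded G_def]])
  \<comment> \<open>The constant is a limit of real numbers.\<close>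
  have "\<alpha> * of_real (sqrt (2 * pi)) \<in> \<real>"
    using Lim_in_closed_set[OF closed_complex_Reals _ _ r[of 0 0]] by simp
  then have "\<alpha> * of_real (sqrt (2 * pi)) / of_real (sqrt (2 * pi)) \<in> \<real>"
    by (intro Reals_divide) auto
  then obtain a where a: "\<alpha> = of_real a" by (auto elim: Reals_cases)
  with \<open>\<alpha> \<noteq> 0\<close> have "a \<noteq> 0" by simp
  have r_lim: "(\<lambda>n. r d n Y) \<longlonglongrightarrow> a * (sqrt (2 * pi) * poly (hermite d) Y)" for Y
    using tendsto_Re[OF r[of d Y]] by (simp add: a)
  obtain y where y: "\<And>i. i < d \<Longrightarrow> y i < y (Suc i)"
    "\<And>i. i \<le> d \<Longrightarrow> 0 < (-1) ^ (d + i) * poly (hermite d) (y i)"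
    using hermite_sign_changes[of d] by auto
  have "eventually (\<lambda>n. 0 < a * (-1) ^ (d + i) * r d n (y i)) sequentially" if "i \<le> d" for i
  proof (rule order_tendstoD(1))
    show "(\<lambda>n. a * (-1) ^ (d + i) * r d n (y i)) \<longlonglongrightarrow> a * (-1) ^ (d + i) * (a * (sqrt (2 * pi) * poly (hermite d) (y i)))"
      by (intro tendsto_intros r_lim)
    have "a * (-1) ^ (d + i) * (a * (sqrt (2 * pi) * poly (hermite d) (y i)))
       = a\<^sup>2 * sqrt (2 * pi) * ((-1) ^ (d + i) * poly (hermite d) (y i))"
      by (simp add: power2_eq_square)
    also have "\<dots> > 0"
      using \<open>a \<noteq> 0\<close> by (intro mult_pos_pos[OF _ y(2)[OF that]]) simp
    finally show "0 < a * (-1) ^ (d + i) * (a * (sqrt (2 * pi) * poly (hermite d) (y i)))" .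
  qed
  then have "eventually (\<lambda>n. \<forall>i\<in>{..d}. 0 < a * (-1) ^ (d + i) * r d n (y i)) sequentially"
    by (intro eventually_ball_finite) auto
  then show ?thesis
    using eventually_gt_at_top[of 0]
  proof eventually_elim
    case (elim n)
    then have s: "0 < sqrt (A / n)" using \<open>0 < A\<close> by simp
    show ?case
    proof (rule turan_inequalities_of_sign_changes[where y = "\<lambda>i. jensen_point A n (y i)" and \<sigma> = "a * (-1) ^ d"])
      show "jensen_point A n (y i) < jensen_point A n (y (Suc i))" if "i < d" for i
        using y(1)[OF that] saddle_width_pos[OF \<open>0 < A\<close> s] by (simp add: jensen_point_def)
      show "0 < a * (-1) ^ d * (-1) ^ i * poly (jensen_poly C d n) (jensen_point A n (y i))" if "i \<le> d" for i
      proof -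
        have "0 < a * (-1) ^ (d + i) * r d n (y i)" using elim(1) that by simp
        also have "\<dots> = a * (-1) ^ d * (-1) ^ i * poly (jensen_poly C d n) (jensen_point A n (y i))
            * (2 * pi / saddle_scale A \<beta> d (sqrt (A / n)))"
          by (simp add: r_def power_add)
        finally show ?thesis
          by (rule zero_less_mult_pos2) (simp add: saddle_scale_pos[OF \<open>0 < A\<close> s])
      qed
    qed
  qed
qed

section \<open>Circle-method data as a power series on the unit disc\<close>

lemma power_series_coeff_unique:
  fixes c c' :: "nat \<Rightarrow> complex"
  assumes "\<And>w. norm w < 1 \<Longrightarrow> (\<lambda>m. c m * w ^ m) sums f w" "\<And>w. norm w < 1 \<Longrightarrow> (\<lambda>m. c' m * w ^ m) sums f w"
  shows "c = c'"
proof
  fix n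
  have *: "((\<lambda>y. f (exp (- Complex 1 y)) * exp (of_nat n * Complex 1 y)) has_integral 2 * of_real pi * a n) {0..0 + 2 * pi}"
    if a: "\<And>w. norm w < 1 \<Longrightarrow> (\<lambda>m. a m * w ^ m) sums f w" for a
  proof -
    have "(\<Sum>m. a m * exp (- Complex 1 y) ^ m) = f (exp (- Complex 1 y))" for y
      by (intro sums_unique[symmetric] a) simp
    then show ?thesis
      using power_series_coeff_integral[of a 1 n 0] a by (simp add: sums_iff)
  qed
  show "c n = c' n"
    using has_integral_unique[OF *[OF assms(1)] *[OF assms(2)]] by simp
qed

lemma q_domain_eq: "q_domain = ball 0 1 - \<real>\<^sub>\<le>\<^sub>0"
proof (intro equalityI subsetI)
  fix q assume "q \<in> q_domain"
  then obtain z where z: "0 < Re z" "\<bar>Im z\<bar> < pi" "q = exp (- z)" by (auto simp: q_domain_def)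
  have "q \<notin> \<real>\<^sub>\<le>\<^sub>0"
  proof
    assume "q \<in> \<real>\<^sub>\<le>\<^sub>0"
    then have "sin (Im z) = 0" "cos (Im z) \<le> 0"
      by (auto simp: z(3) complex_nonpos_Reals_iff Re_exp Im_exp mult_le_0_iff)
    moreover from this z(2) have "Im z = 0" using sin_eq_0_pi[of "Im z"] by (simp add: abs_less_iff)
    ultimately show False by simp
  qed
  with z show "q \<in> ball 0 1 - \<real>\<^sub>\<le>\<^sub>0" by simp
next
  fix q :: complex assume q: "q \<in> ball 0 1 - \<real>\<^sub>\<le>\<^sub>0"
  then have "q \<noteq> 0" by auto
  have "Im (Ln q) \<noteq> pi"
    using q \<open>q \<noteq> 0\<close> by (metis Im_Ln_eq_pi DiffD2 complex_nonpos_Reals_iff less_imp_le)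
  then have "\<bar>Im (- Ln q)\<bar> < pi"
    using mpi_less_Im_Ln[OF \<open>q \<noteq> 0\<close>] Im_Ln_le_pi[OF \<open>q \<noteq> 0\<close>] by (simp add: abs_less_iff)
  moreover have "0 < Re (- Ln q)" using q \<open>q \<noteq> 0\<close> by (simp add: Re_Ln)
  moreover have "q = exp (- (- Ln q))" using \<open>q \<noteq> 0\<close> by simp
  ultimately show "q \<in> q_domain" unfolding q_domain_def by blast
qed

lemma open_q_domain: "open q_domain"
  unfolding q_domain_eq by (intro open_Diff open_ball closed_nonpos_Reals_complex)

lemma connected_q_domain: "connected q_domain"
  unfolding q_domain_def
proof (intro connected_continuous_image convex_connected)
  have "{z. 0 < Re z \<and> \<bar>Im z\<bar> < pi} = {z. Re z > 0} \<inter> {z. Im z < pi} \<inter> {z. Im z > - pi}" by auto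
  then show "convex {z. 0 < Re z \<and> \<bar>Im z\<bar> < pi}"
    by (simp add: convex_Int convex_halfspace_Re_gt convex_halfspace_Im_lt convex_halfspace_Im_gt)
qed (intro continuous_intros)

lemma power_series_converges_on_unit_disc:
  fixes c :: "nat \<Rightarrow> complex"
  assumes expansion: "eventually (\<lambda>q. (\<lambda>n. c n * q ^ n) sums F q) (at 1 within ball 0 1)"
    and "norm w < 1"
  shows "summable (\<lambda>n. c n * w ^ n)"
proof -
  obtain \<epsilon> where \<epsilon>: "0 < \<epsilon>" "\<And>q. q \<in> ball 0 1 \<Longrightarrow> q \<noteq> 1 \<Longrightarrow> dist q 1 < \<epsilon> \<Longrightarrow> (\<lambda>n. c n * q ^ n) sums F q"
    using expansion by (auto simp: eventually_at)
  \<comment> \<open>A radius beyond \<open>w\<close> and close enough to \<open>1\<close> for the expansion to hold.\<close>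
  define \<rho> where "\<rho> = max ((1 + norm w) / 2) (1 - \<epsilon> / 2)"
  have \<rho>: "norm w < \<rho>" "\<rho> < 1" "1 - \<rho> < \<epsilon>"
    using assms(2) \<epsilon>(1) by (auto simp: \<rho>_def less_max_iff_disj)
  then have "0 < \<rho>" by (meson le_less_trans norm_ge_zero)
  have "dist (of_real \<rho>) (1 :: complex) < \<epsilon>"
    using \<rho> dist_of_real[of \<rho> 1, where ?'a = complex] by (simp add: dist_real_def)
  then have "(\<lambda>n. c n * of_real \<rho> ^ n) sums F (of_real \<rho>)"
    using \<rho> \<open>0 < \<rho>\<close> by (intro \<epsilon>(2)) auto
  then show ?thesis
    using \<rho> by (intro powser_inside[of c "of_real \<rho>" w]) (auto simp: sums_iff)
qed

text \<open>Inside the unit disc, points near \<open>1\<close> have norm near \<open>1\<close>, so the local expansion already gives convergence on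
the disc. The identity theorem on the connected slit disc then identifies the sum with \<open>F\<close>.\<close>

lemma power_series_sums_on_q_domain:
  assumes analytic: "F analytic_on q_domain"
    and expansion: "eventually (\<lambda>q. (\<lambda>n. c n * q ^ n) sums F q) (at 1 within ball 0 1)"
    and "q \<in> q_domain"
  shows "(\<lambda>n. c n * q ^ n) sums F q"
proof -
  define P where "P q = (\<Sum>n. c n * q ^ n)" for q
  have sums: "(\<lambda>n. c n * q ^ n) sums P q" if "norm q < 1" for q
    unfolding P_def by (intro summable_sums power_series_converges_on_unit_disc[OF expansion] that)
  have P_holo: "P holomorphic_on ball 0 1"
    by (rule power_series_holomorphic[where a = c]) (simp add: sums)
  obtain \<epsilon> where \<epsilon>: "0 < \<epsilon>" "\<And>q. q \<in> ball 0 1 \<Longrightarrow> q \<noteq> 1 \<Longrightarrow> dist q 1 < \<epsilon> \<Longrightarrow> (\<lambda>n. c n * q ^ n) sums F q"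
    using expansion by (auto simp: eventually_at)
  let ?U = "q_domain \<inter> ball 1 \<epsilon>"
  define \<rho> where "\<rho> = max (1 / 2) (1 - \<epsilon> / 2)"
  have \<rho>: "0 < \<rho>" "\<rho> < 1" "1 - \<rho> < \<epsilon>" using \<epsilon>(1) by (auto simp: \<rho>_def max_def)
  have "dist 1 (complex_of_real \<rho>) < \<epsilon>"
    using \<rho> dist_of_real[of 1 \<rho>, where ?'a = complex] by (simp add: dist_real_def)
  then have ne: "of_real \<rho> \<in> ?U" using \<rho> by (simp add: q_domain_eq)
  have "F q = P q"
  proof (rule analytic_continuation_open[of ?U q_domain F P])
    show "F holomorphic_on q_domain" using analytic by (rule analytic_imp_holomorphic)
    show "P holomorphic_on q_domain"
      using P_holo by (rule holomorphic_on_subset) (auto simp: q_domain_eq)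
    show "F z = P z" if "z \<in> ?U" for z
    proof -
      have "norm z < 1" "z \<noteq> 1" "dist z 1 < \<epsilon>" using that by (auto simp: q_domain_eq dist_commute)
      then show ?thesis by (intro sums_unique2[OF \<epsilon>(2) sums]) auto
    qed
  qed (use ne assms(3) open_q_domain connected_q_domain in auto)
  then show ?thesis using sums[of q] assms(3) by (simp add: q_domain_eq)
qed

text \<open>The invariance is given only where a point and its rotation both avoid the slit. It extends to the disc by
analytic continuation, and comparing coefficients yields \<open>c n = c n * \<zeta> ^ n\<close>.\<close>

lemma rotation_invariant_coeff_eq_0:
  fixes c :: "nat \<Rightarrow> complex"
  assumes "0 < K" and conv: "\<And>w. norm w < 1 \<Longrightarrow> summable (\<lambda>n. c n * w ^ n)"
    and F: "\<And>q. q \<in> q_domain \<Longrightarrow> (\<lambda>n. c n * q ^ n) sums F q"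
  defines "\<zeta> \<equiv> exp (2 * of_real pi * \<i> / of_nat K)"
  assumes symmetry: "\<And>q. q \<in> q_domain \<Longrightarrow> \<zeta> * q \<in> q_domain \<Longrightarrow> F (\<zeta> * q) = F q"
    and "\<not> K dvd n"
  shows "c n = 0"
proof -
  have "K \<noteq> 1" using \<open>\<not> K dvd n\<close> by auto
  with \<open>0 < K\<close> have "2 \<le> K" by simp
  have \<zeta>: "norm \<zeta> = 1" "\<zeta> ^ n \<noteq> 1"
  proof -
    show "norm \<zeta> = 1" by (simp add: \<zeta>_def)
    have "\<zeta> ^ n = exp (2 * of_real pi * \<i> * of_nat n / of_nat K)"
      by (simp add: \<zeta>_def exp_of_nat_mult[symmetric] mult_ac)
    then show "\<zeta> ^ n \<noteq> 1"
      using complex_root_unity_eq_1[of K n] \<open>2 \<le> K\<close> \<open>\<not> K dvd n\<close> by simp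
  qed
  define P where "P q = (\<Sum>n. c n * q ^ n)" for q
  have sums: "(\<lambda>n. c n * q ^ n) sums P q" if "norm q < 1" for q
    unfolding P_def by (intro summable_sums conv that)
  have P_holo: "P holomorphic_on ball 0 1"
    by (rule power_series_holomorphic[where a = c]) (simp add: sums)
  have F_eq: "F q = P q" if "q \<in> q_domain" for q
    using F[OF that] sums[of q] that by (auto simp: q_domain_eq intro: sums_unique2)
  let ?U = "q_domain \<inter> (\<lambda>q. \<zeta> * q) -` q_domain"
  \<comment> \<open>A point and its rotation that lie symmetrically about the positive real axis.\<close>
  define q0 where "q0 = exp (- (Complex 1 (pi / K)))"
  have "pi / K < pi" using \<open>2 \<le> K\<close> by (simp add: divide_less_eq)
  then have "q0 \<in> q_domain" unfolding q0_def q_domain_def using \<open>0 < K\<close> by (intro imageI) simp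
  moreover have "\<zeta> * q0 = exp (- (Complex 1 (- (pi / K))))"
    unfolding \<zeta>_def q0_def exp_add[symmetric] by (intro arg_cong[where f = exp]) (simp add: complex_eq_iff)
  then have "\<zeta> * q0 \<in> q_domain" unfolding q_domain_def using \<open>pi / K < pi\<close> by simp
  ultimately have ne: "q0 \<in> ?U" by simp
  have P_rot: "P (\<zeta> * q) = P q" if "norm q < 1" for q
  proof (rule analytic_continuation_open[of ?U "ball 0 1" "\<lambda>q. P (\<zeta> * q)" P])
    show "open ?U" by (intro open_Int open_vimage open_q_domain continuous_intros)
    show "(\<lambda>q. P (\<zeta> * q)) holomorphic_on ball 0 1"
      by (rule holomorphic_on_compose_gen[OF _ P_holo, unfolded o_def, of "\<lambda>q. \<zeta> * q"])
        (use \<zeta>(1) in \<open>auto simp: norm_mult intro!: holomorphic_intros\<close>)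
    show "P (\<zeta> * z) = P z" if "z \<in> ?U" for z
      using symmetry[of z] that F_eq by auto
  qed (use ne that P_holo in \<open>auto simp: q_domain_eq\<close>)
  have "c = (\<lambda>n. c n * \<zeta> ^ n)"
  proof (rule power_series_coeff_unique[OF sums])
    show "(\<lambda>m. c m * \<zeta> ^ m * w ^ m) sums P w" if "norm w < 1" for w
      using sums[of "\<zeta> * w"] P_rot[OF that] that \<zeta>(1) by (simp add: norm_mult power_mult_distrib mult.assoc)
  qed
  then have "c n = c n * \<zeta> ^ n" by (rule fun_cong)
  with \<zeta>(2) show ?thesis by (metis mult_cancel_left mult.right_neutral)
qed

section \<open>Passing to every K-th coefficient\<close>

lemma sum_divided_by_leading_power_tendsto:
  fixes \<alpha> :: "nat \<Rightarrow> complex"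
  assumes "m < N" and zero: "\<And>j. j < m \<Longrightarrow> \<alpha> j = 0"
    and error: "E \<in> O[at 0 within S](\<lambda>z. of_real (norm z ^ N))"
  shows "((\<lambda>z. ((\<Sum>j<N. \<alpha> j * z ^ j) + E z) / z ^ m) \<longlongrightarrow> \<alpha> m) (at 0 within S)"
proof -
  have "((\<lambda>z. \<Sum>j<N. \<alpha> j * z ^ (j - m)) \<longlongrightarrow> (\<Sum>j<N. \<alpha> j * 0 ^ (j - m))) (at 0 within S)"
    by (intro tendsto_intros)
  also have "(\<Sum>j<N. \<alpha> j * 0 ^ (j - m)) = (\<Sum>j<N. if j = m then \<alpha> m else 0)"
    using zero by (intro sum.cong) (auto simp: power_0_left linorder_neq_iff)
  also have "\<dots> = \<alpha> m" using \<open>m < N\<close> by simp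
  finally have main: "((\<lambda>z. \<Sum>j<N. \<alpha> j * z ^ (j - m)) \<longlongrightarrow> \<alpha> m) (at 0 within S)" .
  obtain b where b: "eventually (\<lambda>z. norm (E z) \<le> b * norm z ^ N) (at 0 within S)"
    using landau_o.bigE[OF error] by (auto simp: norm_power)
  have ne: "eventually (\<lambda>z. z \<noteq> 0) (at 0 within S)" by (simp add: eventually_at_filter)
  have "((\<lambda>z. E z / z ^ m) \<longlongrightarrow> 0) (at 0 within S)"
  proof (rule Lim_null_comparison)
    show "eventually (\<lambda>z. norm (E z / z ^ m) \<le> b * norm z ^ (N - m)) (at 0 within S)"
      using b ne by eventually_elim
        (use \<open>m < N\<close> in \<open>simp add: norm_divide norm_power divide_le_eq mult.assoc flip: power_add\<close>)
    have "((\<lambda>z. b * norm z ^ (N - m)) \<longlongrightarrow> b * norm (0 :: complex) ^ (N - m)) (at 0 within S)"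
      by (intro tendsto_intros)
    then show "((\<lambda>z. b * norm (z :: complex) ^ (N - m)) \<longlongrightarrow> 0) (at 0 within S)"
      using \<open>m < N\<close> by (simp add: power_0_left)
  qed
  from tendsto_add[OF main this]
  have "((\<lambda>z. (\<Sum>j<N. \<alpha> j * z ^ (j - m)) + E z / z ^ m) \<longlongrightarrow> \<alpha> m) (at 0 within S)" by simp
  moreover have "eventually (\<lambda>z. (\<Sum>j<N. \<alpha> j * z ^ (j - m)) + E z / z ^ m
      = ((\<Sum>j<N. \<alpha> j * z ^ j) + E z) / z ^ m) (at 0 within S)"
    using ne
  proof eventually_elim
    case (elim z)
    have "\<alpha> j * z ^ (j - m) = \<alpha> j * z ^ j / z ^ m" for j
      using elim zero[of j] by (cases "j < m") (simp_all add: power_diff)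
    then show ?case by (simp add: add_divide_distrib sum_divide_distrib)
  qed
  ultimately show ?thesis by (rule Lim_transform_eventually)
qed

text \<open>In the coordinate \<open>w = K z\<close>, the first nonvanishing term \<open>\<alpha> m * z ^ m\<close> dominates the expansion and raises the
exponent \<open>B\<close> to \<open>B + m\<close>.\<close>

lemma major_arc_ratio_tendsto:
  fixes K A B :: real and m :: nat and \<alpha> :: "nat \<Rightarrow> complex"
  defines "\<beta> \<equiv> B + real m"
  assumes "0 < K" "m < N" and below: "\<And>j. j < m \<Longrightarrow> \<alpha> j = 0"
    and error: "E \<in> O[at 0 within major_cone M](\<lambda>z. of_real (norm z ^ N))"
    and G: "\<forall>\<^sub>F w in at 0 within major_cone M. G w = (w / of_real K) powr of_real B * exp (of_real A / (w / of_real K))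
        * ((\<Sum>j<N. \<alpha> j * (w / of_real K) ^ j) + E (w / of_real K))"
  shows "((\<lambda>w. G w / (w powr of_real \<beta> * exp (of_real (A * K) / w)))
      \<longlongrightarrow> of_real (K powr - \<beta>) * \<alpha> m) (at 0 within major_cone M)"
proof -
  have "filterlim (\<lambda>w. w / of_real K) (at 0 within major_cone M) (at 0 within major_cone M)"
    unfolding filterlim_at
  proof
    have "((\<lambda>w. w / of_real K) \<longlongrightarrow> 0 / complex_of_real K) (at 0 within major_cone M)"
      using \<open>0 < K\<close> by (intro tendsto_intros) auto
    then show "((\<lambda>w. w / complex_of_real K) \<longlongrightarrow> 0) (at 0 within major_cone M)" by simp
    show "\<forall>\<^sub>F w in at 0 within major_cone M. w / complex_of_real K \<in> major_cone M \<and> w / of_real K \<noteq> 0"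
      unfolding eventually_at_filter
      using \<open>0 < K\<close> by (intro always_eventually) (auto simp: major_cone_def divide_right_mono)
  qed
  from tendsto_mult_left[OF filterlim_compose[OF sum_divided_by_leading_power_tendsto[OF \<open>m < N\<close> below error] this]]
  have "((\<lambda>w. of_real (K powr - \<beta>) * (((\<Sum>j<N. \<alpha> j * (w / of_real K) ^ j) + E (w / of_real K)) / (w / of_real K) ^ m))
      \<longlongrightarrow> of_real (K powr - \<beta>) * \<alpha> m) (at 0 within major_cone M)" .
  moreover have "\<forall>\<^sub>F w in at 0 within major_cone M.
      of_real (K powr - \<beta>) * (((\<Sum>j<N. \<alpha> j * (w / of_real K) ^ j) + E (w / of_real K)) / (w / of_real K) ^ m)
      = G w / (w powr of_real \<beta> * exp (of_real (A * K) / w))"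
  proof -
    have "\<forall>\<^sub>F w in at 0 within major_cone M. w \<noteq> 0" by (simp add: eventually_at_filter)
    with G show ?thesis
    proof eventually_elim
      case (elim w)
      define z where "z = w / of_real K"
      have wz: "w = of_real K * z" and "z \<noteq> 0" using \<open>0 < K\<close> elim(2) by (simp_all add: z_def)
      have "w powr of_real \<beta> = of_real (K powr \<beta>) * (z powr of_real B * z ^ m)"
      proof -
        have "w powr of_real \<beta> = of_real K powr of_real \<beta> * z powr of_real \<beta>"
          unfolding wz using \<open>0 < K\<close> by (intro powr_times_real_left) auto
        also have "z powr of_real \<beta> = z powr of_real B * z powr of_nat m"
          by (simp add: \<beta>_def powr_add)
        also have "z powr of_nat m = z ^ m" using \<open>z \<noteq> 0\<close> by (simp add: powr_nat)
        also have "of_real K powr of_real \<beta> = complex_of_real (K powr \<beta>)"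
          using \<open>0 < K\<close> by (intro powr_of_real) simp
        finally show ?thesis .
      qed
      moreover have "exp (of_real (A * K) / w) = exp (of_real A / z)"
        using \<open>0 < K\<close> by (simp add: wz)
      moreover have "z powr of_real B \<noteq> 0" using \<open>z \<noteq> 0\<close> by simp
      moreover have "K powr \<beta> \<noteq> 0" using \<open>0 < K\<close> by simp
      ultimately show ?case
        unfolding elim(1) z_def[symmetric] using \<open>z \<noteq> 0\<close> by (simp add: powr_minus field_simps)
    qed
  qed
  ultimately show ?thesis by (rule Lim_transform_eventually)
qed

text \<open>The minor arc may run beyond \<open>y = \<pi>\<close>, where \<open>- Complex x y\<close> has to be moved by a full period. At \<open>y = \<pi>\<close>
itself the point lies on the slit.\<close>

lemma exp_mem_q_domain:
  assumes "0 < x" "0 < y" "y < 2 * pi" "y \<noteq> pi"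
  shows "exp (- Complex x y) \<in> q_domain"
proof (cases "y < pi")
  case True
  then show ?thesis using assms unfolding q_domain_def by auto
next
  case False
  have "- Complex x y + \<i> * (of_int 1 * (of_real pi * 2)) = - Complex x (y - 2 * pi)"
    by (simp add: complex_eq_iff)
  then have "exp (- Complex x y) = exp (- Complex x (y - 2 * pi))"
    using exp_plus_2pin[of "- Complex x y" 1] by simp
  also have "\<dots> \<in> q_domain"
    using False assms unfolding q_domain_def by (intro imageI) auto
  finally show ?thesis .
qed

text \<open>For \<open>K = 1\<close> the minor arc crosses the slit, and at that one point \<open>F\<close> need not agree with the power
series; the bound for the series is recovered there by continuity.\<close>

lemma continuous_le_except_point:
  fixes f :: "real \<Rightarrow> real"
  assumes cont: "continuous_on {a..b} f" and "a < b"
    and le: "\<And>y. y \<in> {a..b} \<Longrightarrow> y \<noteq> p \<Longrightarrow> f y \<le> u" and "y \<in> {a..b}"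
  shows "f y \<le> u"
proof (cases "y = p")
  case True
  have "(f \<longlongrightarrow> f y) (at y within {a..b})"
    using cont \<open>y \<in> {a..b}\<close> by (simp add: continuous_on)
  moreover have "eventually (\<lambda>x. f x \<le> u) (at y within {a..b})"
    unfolding eventually_at_filter using le True by (intro always_eventually) auto
  moreover have "at y within {a..b} \<noteq> bot"
    using \<open>a < b\<close> \<open>y \<in> {a..b}\<close> by (simp add: trivial_limit_within islimpt_Icc)
  ultimately show ?thesis by (rule tendsto_upperbound)
qed (use assms in auto)

theorem theorem1p2:
  fixes K N :: nat and M A B \<kappa> :: real
    and F :: "complex \<Rightarrow> complex" and c :: "nat \<Rightarrow> complex"
    and \<alpha> :: "nat \<Rightarrow> complex" and E :: "complex \<Rightarrow> complex"
    and C :: "nat \<Rightarrow> real"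
  assumes "0 < K" and "0 < N" and "0 < M" and "0 < A" and "0 < B" and "0 < \<kappa>"
    and analytic: "F analytic_on q_domain"
    and expansion: "\<forall>\<^sub>F q in at 1 within ball 0 1. (\<lambda>n. c n * q ^ n) sums F q"
    and symmetry: "\<And>q. q \<in> q_domain \<Longrightarrow> exp (2 * of_real pi * \<i> / of_nat K) * q \<in> q_domain
                     \<Longrightarrow> F (exp (2 * of_real pi * \<i> / of_nat K) * q) = F q"
    and nonzero: "\<exists>j<N. \<alpha> j \<noteq> 0"
    and major_arc: "\<And>z. z \<in> major_cone M \<Longrightarrow>
          F (exp (- z)) = z powr of_real B * exp (of_real A / z) * ((\<Sum>j<N. \<alpha> j * z ^ j) + E z)"
    and error: "E \<in> O[at 0 within major_cone M](\<lambda>z. of_real (norm z ^ N))"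
    and minor_arc: "\<exists>L. \<forall>\<^sub>F x in at_right 0. \<forall>y\<in>{M * x..2 * pi / of_nat K - M * x}.
          norm (F (exp (- Complex x y))) \<le> L * exp (1 / x * (A - \<kappa>))"
    and C: "\<And>n. complex_of_real (C n) = c (K * n)"
  shows "\<forall>d\<ge>1. \<forall>\<^sub>F n in sequentially. turan_inequalities C d n"
proof -
  let ?K = "real K"
  have K: "0 < ?K" using \<open>0 < K\<close> by simp
  note conv_c = power_series_converges_on_unit_disc[OF expansion]
  note F_sums = power_series_sums_on_q_domain[OF analytic expansion]
  have c_0: "c n = 0" if "\<not> K dvd n" for n
    using rotation_invariant_coeff_eq_0[OF \<open>0 < K\<close> conv_c F_sums symmetry that] .
  have sums_C: "(\<lambda>m. of_real (C m) * (q ^ K) ^ m) sums S \<longleftrightarrow> (\<lambda>n. c n * q ^ n) sums S" for q S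
  proof -
    have "c n * q ^ n = 0" if "n \<notin> range (\<lambda>m. K * m)" for n
      using c_0[of n] that by (auto elim: dvdE)
    then show ?thesis
      using sums_mono_reindex[of "\<lambda>m. K * m" "\<lambda>n. c n * q ^ n" S] \<open>0 < K\<close>
      by (simp add: C strict_mono_def power_mult)
  qed
  have conv: "summable (\<lambda>m. complex_of_real (C m) * w ^ m)" if "norm w < 1" for w
  proof -
    obtain q where q: "w = q ^ K"
      using exists_complex_root[of K w] \<open>0 < K\<close> by auto
    have "norm q < 1"
      using that \<open>0 < K\<close> by (metis q norm_power norm_ge_zero not_le one_le_power)
    from conv_c[OF this] show ?thesis
      unfolding q using sums_C summable_def by metis
  qed
  define G where "G = (\<lambda>w. \<Sum>m. complex_of_real (C m) * exp (- w) ^ m)"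
  have G_eq: "G w = F (exp (- (w / of_real ?K)))" if "exp (- (w / of_real ?K)) \<in> q_domain" for w :: complex
  proof -
    have "exp (- (w / of_real ?K)) ^ K = exp (- w)"
      using \<open>0 < K\<close> by (simp add: exp_of_nat_mult[symmetric])
    moreover have "(\<lambda>m. of_real (C m) * (exp (- (w / of_real ?K)) ^ K) ^ m) sums F (exp (- (w / of_real ?K)))"
      unfolding sums_C by (rule F_sums[OF that])
    ultimately show ?thesis
      unfolding G_def by (simp only: sums_unique[symmetric])
  qed
  \<comment> \<open>The leading coefficient may vanish, so the first nonzero one takes its place.\<close>
  define m where "m = (LEAST j. \<alpha> j \<noteq> 0)"
  obtain j where j: "j < N" "\<alpha> j \<noteq> 0" using nonzero by auto
  have "\<alpha> m \<noteq> 0" unfolding m_def using j(2) by (rule LeastI)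
  have "m \<le> j" unfolding m_def using j(2) by (rule Least_le)
  with j have "m < N" by simp
  have below: "\<alpha> i = 0" if "i < m" for i using not_less_Least that unfolding m_def by blast
  define \<beta> where "\<beta> = B + m"
  have near_0: "\<forall>\<^sub>F w in at 0 within major_cone M. G w = F (exp (- (w / of_real ?K)))"
    unfolding eventually_at
  proof (intro exI[of _ "?K * pi"] conjI ballI impI)
    show "0 < ?K * pi" using K by simp
    fix w assume w: "w \<in> major_cone M" "w \<noteq> 0 \<and> dist w 0 < ?K * pi"
    have "\<bar>Im w\<bar> < ?K * pi" using w(2) abs_Im_le_cmod[of w] by simp
    then have "exp (- (w / of_real ?K)) \<in> q_domain"
      using w(1) K unfolding q_domain_def major_cone_def
      by (intro imageI) (simp add: divide_less_eq mult.commute)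
    then show "G w = F (exp (- (w / of_real ?K)))" by (rule G_eq)
  qed
  have in_cone: "\<forall>\<^sub>F w in at 0 within major_cone M. w \<in> major_cone M"
    by (simp add: eventually_at_filter)
  have lim: "((\<lambda>w. G w / (w powr of_real \<beta> * exp (of_real (A * ?K) / w)))
      \<longlongrightarrow> of_real (?K powr - \<beta>) * \<alpha> m) (at 0 within major_cone M)"
    unfolding \<beta>_def
  proof (rule major_arc_ratio_tendsto[OF K \<open>m < N\<close> below error])
    show "\<forall>\<^sub>F w in at 0 within major_cone M. G w = (w / of_real ?K) powr of_real B * exp (of_real A / (w / of_real ?K))
        * ((\<Sum>j<N. \<alpha> j * (w / of_real ?K) ^ j) + E (w / of_real ?K))"
      using near_0 in_cone
    proof eventually_elim
      case (elim w)
      then have "w / of_real ?K \<in> major_cone M"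
        using K by (auto simp: major_cone_def divide_right_mono)
      with elim(1) show ?case by (simp only: major_arc)
    qed
  qed
  obtain L where "\<forall>\<^sub>F x in at_right 0. \<forall>y\<in>{M * x..2 * pi / ?K - M * x}.
      norm (F (exp (- Complex x y))) \<le> L * exp (1 / x * (A - \<kappa>))"
    using minor_arc by auto
  moreover have "filterlim (\<lambda>x. x / ?K) (at_right 0) (at_right 0)" using K by real_asymp
  ultimately have "\<forall>\<^sub>F x in at_right 0. \<forall>y\<in>{M * (x / ?K)..2 * pi / ?K - M * (x / ?K)}.
      norm (F (exp (- Complex (x / ?K) y))) \<le> L * exp (1 / (x / ?K) * (A - \<kappa>))"
    by (rule eventually_compose_filterlim)
  moreover have "\<forall>\<^sub>F x in at_right 0. M * x < pi" using \<open>0 < M\<close> by real_asymp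
  ultimately have minor: "\<forall>\<^sub>F x in at_right 0. \<forall>y\<in>{M * x..2 * pi - M * x}.
      norm (G (Complex x y)) \<le> L * exp ((A * ?K - \<kappa> * ?K) / x)"
    using eventually_at_right_less[of 0]
  proof eventually_elim
    case (elim x)
    have Mx: "0 < M * x" using elim \<open>0 < M\<close> by simp
    have "continuous_on {M * x..2 * pi - M * x} (\<lambda>y. G (Complex x y))"
      unfolding G_def
      by (rule continuous_on_compose2[OF continuous_on_power_series_exp[OF conv]])
        (use elim in \<open>auto simp: Complex_eq intro!: continuous_intros\<close>)
    then have cont: "continuous_on {M * x..2 * pi - M * x} (\<lambda>y. norm (G (Complex x y)))"
      by (rule continuous_on_norm)
    have "norm (G (Complex x y)) \<le> L * exp ((A * ?K - \<kappa> * ?K) / x)"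
      if y: "y \<in> {M * x..2 * pi - M * x}" "y \<noteq> ?K * pi" for y
    proof -
      have "y < 2 * pi" using y Mx by simp
      have "Complex x y / of_real ?K = Complex (x / ?K) (y / ?K)" by (simp add: complex_eq_iff)
      moreover have "exp (- Complex (x / ?K) (y / ?K)) \<in> q_domain"
      proof (rule exp_mem_q_domain)
        have "y / ?K \<le> y" using \<open>0 < K\<close> y(1) Mx by (simp add: divide_le_eq mult_le_cancel_left1)
        with \<open>y < 2 * pi\<close> show "y / ?K < 2 * pi" by simp
      qed (use elim K y Mx in \<open>auto simp: field_simps\<close>)
      moreover have "y / ?K \<in> {M * (x / ?K)..2 * pi / ?K - M * (x / ?K)}"
        using y K by (auto simp: field_simps)
      ultimately have "norm (G (Complex x y)) \<le> L * exp (1 / (x / ?K) * (A - \<kappa>))"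
        using elim(1) G_eq[of "Complex x y"] by simp
      also have "1 / (x / ?K) * (A - \<kappa>) = (A * ?K - \<kappa> * ?K) / x" by (simp add: algebra_simps)
      finally show ?thesis .
    qed
    then show ?case
      using continuous_le_except_point[OF cont, of "?K * pi"] elim by auto
  qed
  have "\<forall>\<^sub>F n in sequentially. turan_inequalities C d n" for d
  proof (rule turan_inequalities_of_saddle_asymptotics[where A = "A * ?K" and \<kappa> = "\<kappa> * ?K" and M = M])
    show "0 < A * ?K" "0 < \<kappa> * ?K" "0 < M" using K \<open>0 < A\<close> \<open>0 < \<kappa>\<close> \<open>0 < M\<close> by simp_all
    show "of_real (?K powr - \<beta>) * \<alpha> m \<noteq> 0" using K \<open>\<alpha> m \<noteq> 0\<close> by simp
  qed (use conv lim minor in \<open>simp_all add: G_def\<close>)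
  then show ?thesis by blast
qed

end
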